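(* Let $S=S(\boldsymbol{\mathcal U}_m,\boldsymbol\Delta,\boldsymbol R)$ be a piecewise Chebyshevian spline space with knots of zero multiplicity which contains constants, and whose transition functions $f_{1,m},\dots,f_{m,m}$ relative to $[a,b]$ exist and are linearly independent. Consider the functions $w_j$, $j=1,\dots,m-1$, generated recursively by $$w_j=\sum_{\ell=2}^{m-j+1}Df_{\ell,m-j+1},\qquad f_{\ell,m-j}=\frac{\sum_{h=\ell+1}^{m-j+1}Df_{h,m-j+1}}{w_j},\quad \ell=1,\dots,m-j,$$ and suppose that all of $w_1,\dots,w_{m-1}$ are positive. Then $S$ is an ECP-space associated with the system of piecewise weight functions $\{\mathbb 1,w_1,\dots,w_{m-1}\}$. Moreover, $DS$ is an ECP-space associated with $\{w_1,\dots,w_{m-1}\}$.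
   Context: Setting. Let $m\ge 2$, $I=[a,b]$ a closed bounded interval, $\boldsymbol\Delta=\{x_1,\dots,x_k\}$ with $a=x_0<x_1<\dots<x_k<x_{k+1}=b$, and $I_i=[x_i,x_{i+1}]$, $i=0,\dots,k$. A piecewise function on $(I,\boldsymbol\Delta)$ is a function $F$ defined separately on each $I_i$, with restriction $F^{[i]}$ to $I_i$ (so $F(x_i^-)=F^{[i-1]}(x_i)$ and $F(x_i^+)=F^{[i]}(x_i)$ may differ); it is piecewise $C^n$ if each $F^{[i]}\in C^n(I_i)$, and positive if each $F^{[i]}$ is positive on the closed interval $I_i$. $D$ denotes ordinary differentiation, applied separately on each $I_i$. $\mathbb 1$ is the constant function $1$. EC-space. An $n$-dimensional space $\mathcal U\subset C^{n-1}(J)$, $n\geq 1$, on a closed bounded interval $J$ is an Extended Chebyshev space (EC-space) on $J$ if any nonzero element vanishes at most $n-1$ times in $J$, counting multiplicities up to $n$. Spline space with knots of zero multiplicity. $\boldsymbol{\mathcal U}_m=\{\mathcal U_{0,m},\dots,\mathcal U_{k,m}\}$, where each $\mathcal U_{i,m}\subset C^{m-1}(I_i)$ is an $m$-dimensional EC-space on $I_i$. Standing assumption: each $\mathcal U_{i,m}$ contains constants and $D\mathcal U_{i,m}$ is an $(m-1)$-dimensional EC-space on $I_i$. $\boldsymbol R=\{R_1,\dots,R_k\}$, where each $R_i$ is an $m\times m$ lower triangular real matrix with positive diagonal entries and with first row and first column equal to $(1,0,\dots,0)$. $S(\boldsymbol{\mathcal U}_m,\boldsymbol\Delta,\boldsymbol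 R)$ is the ($m$-dimensional) space of all piecewise $C^{m-1}$ functions $s$ on $(I,\boldsymbol\Delta)$ with $s^{[i]}\in\mathcal U_{i,m}$ for $i=0,\dots,k$ and $$\big(D^0s^{[i]}(x_i),\dots,D^{m-1}s^{[i]}(x_i)\big)^T=R_i\,\big(D^0s^{[i-1]}(x_i),\dots,D^{m-1}s^{[i-1]}(x_i)\big)^T,\quad i=1,\dots,k.$$ $DS=\{DF: F\in S\}$. ECP-space. Let $E$ be $S$ (with $n=m$) or $DS$ (with $n=m-1$); its elements are piecewise $C^{n-1}$ and their left and right derivative vectors at $x_i$ are connected by a lower triangular matrix with positive diagonal, so $x_i^+$ is a zero of multiplicity $r\le n$ of $F\in E$ if and only if $x_i^-$ is; such a zero is counted once. Let $Z_n(F)$ be the total number of zeros of $F$ in $I$, counting multiplicities up to $n$. $E$ is an ($n$-dimensional) Extended Chebyshev Piecewise space (ECP-space) on $(I,\boldsymbol\Delta)$ if $Z_n(F)\le n-1$ for every nonzero $F\in E$. Weight functions. A system of $n$ piecewise weight functions is a sequence $\{v_0,\dots,v_{n-1}\}$ of piecewise functions on $(I,\boldsymbol\Delta)$ such that each $v_j$ is positive and piecewise $C^{n-j-1}$. Its generalized derivatives are $L_0F=F/v_0$, $L_jF=\frac1{v_j}DL_{j-1}F$, $j=1,\dots,n-1$, for $F$ piecewise $C^{n-1}$. An $n$-dimensional space $E$ is an ECP-space associated with $\{v_0,\dots,v_{n-1}\}$ (written $E=ECP(v_0,\dots,v_{n-1})$) if $E$ is an ECP-space and is the set of all piecewise $C^{n-1}$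 functions $F$ on $(I,\boldsymbol\Delta)$ such that $L_{n-1}F$ is constant on $I$ and $L_jF^{[i]}(x_i)=L_jF^{[i-1]}(x_i)$ for $i=1,\dots,k$, $j=0,\dots,n-1$. For $S$ one takes $n=m$ and $(v_0,\dots,v_{m-1})=(\mathbb 1,w_1,\dots,w_{m-1})$; for $DS$ one takes $n=m-1$ and $(v_0,\dots,v_{m-2})=(w_1,\dots,w_{m-1})$. Transition functions. The transition functions relative to $[a,b]$ are the functions $f_{\ell,m}\in S$, $\ell=1,\dots,m$, such that $f_{1,m}\equiv1$ and, for $\ell=2,\dots,m$, $$D^rf_{\ell,m}(a)=0,\ r=0,\dots,\ell-2,\qquad D^rf_{\ell,m}(b)=\delta_{r,0},\ r=0,\dots,m-\ell.$$ Recursion. Starting from the transition functions $f_{\ell,m}$, the recursion produces for $j=1,2,\dots,m-1$ first $w_j$ and then, provided $w_j$ is positive, the functions $f_{\ell,m-j}$, $\ell=1,\dots,m-j$, used at the next step. *)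

theory Defs
  imports
    "HOL-Analysis.Analysis"
    "HOL-Library.Function_Division"
    "HOL-Library.Extended_Nat"
begin

text \<open>
  Pointwise real vector space structure on functions, so that \<^const>\<open>subspace\<close>, \<^const>\<open>dim\<close> and
  \<^const>\<open>independent\<close> apply to function spaces.
\<close>

instantiation "fun" :: (type, real_vector) real_vector
begin

definition scaleR_fun :: "real \<Rightarrow> ('a \<Rightarrow> 'b) \<Rightarrow> 'a \<Rightarrow> 'b" where
  "scaleR_fun c f = (\<lambda>t. c *\<^sub>R f t)"

instance
  by standard (auto simp: scaleR_fun_def fun_eq_iff scaleR_add_right scaleR_add_left)

end

text \<open>
  A function on a set \<open>J\<close> is represented by its extension by zero outside \<open>J\<close>; hence equality,
  linear independence and dimension refer to the values on \<open>J\<close> only. Derivatives at the endpoints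
  of an interval \<open>J\<close> are one-sided.
\<close>

definition const_on :: "real set \<Rightarrow> real \<Rightarrow> real \<Rightarrow> real" where
  "const_on J c = (\<lambda>t. if t \<in> J then c else 0)"

definition deriv_on :: "real set \<Rightarrow> (real \<Rightarrow> real) \<Rightarrow> real \<Rightarrow> real" where
  "deriv_on J f = (\<lambda>t. if t \<in> J then vector_derivative f (at t within J) else 0)"

definition C_on :: "nat \<Rightarrow> real set \<Rightarrow> (real \<Rightarrow> real) set" where
  "C_on n J = {f. (\<forall>t. t \<notin> J \<longrightarrow> f t = 0) \<and>
     (\<forall>r<n. (deriv_on J ^^ r) f differentiable_on J) \<and>
     continuous_on J ((deriv_on J ^^ n) f)}"

text \<open>Multiplicity of \<open>t\<close> as a zero of \<open>f\<close>, counted up to \<open>n\<close> (it is \<open>0\<close> if \<open>f t \<noteq> 0\<close>).\<close>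

definition zero_mult :: "nat \<Rightarrow> real set \<Rightarrow> (real \<Rightarrow> real) \<Rightarrow> real \<Rightarrow> nat" where
  "zero_mult n J f t = Max {r. r \<le> n \<and> (\<forall>q<r. (deriv_on J ^^ q) f t = 0)}"

definition total_mult :: "real set \<Rightarrow> (real \<Rightarrow> nat) \<Rightarrow> enat" where
  "total_mult A \<mu> =
     (if finite {t \<in> A. \<mu> t \<noteq> 0} then enat (\<Sum>t\<in>{t \<in> A. \<mu> t \<noteq> 0}. \<mu> t) else \<infinity>)"

text \<open>As \<open>n \<ge> 1\<close>, the condition \<^prop>\<open>dim U = n\<close> rules out infinite-dimensional spaces, for which
  \<^const>\<open>dim\<close> is \<open>0\<close>.\<close>

definition EC_space :: "nat \<Rightarrow> real set \<Rightarrow> (real \<Rightarrow> real) set \<Rightarrow> bool" where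
  "EC_space n J U \<longleftrightarrow> n \<ge> 1 \<and> subspace U \<and> dim U = n \<and> U \<subseteq> C_on (n - 1) J \<and>
     (\<forall>f\<in>U. f \<noteq> 0 \<longrightarrow> total_mult J (zero_mult n J f) \<le> enat (n - 1))"

text \<open>
  The partition is given by \<open>x 0 < x 1 < \<dots> < x (k + 1)\<close>. A piecewise function \<open>F\<close> consists of its
  restrictions \<open>F i\<close> to the closed intervals \<open>piece x i\<close>, \<open>i \<le> k\<close>, each extended by zero; the
  components with \<open>i > k\<close> carry no information and are zero.
\<close>

type_synonym pwfun = "nat \<Rightarrow> real \<Rightarrow> real"

definition piece :: "(nat \<Rightarrow> real) \<Rightarrow> nat \<Rightarrow> real set" where
  "piece x i = {x i..x (Suc i)}"

definition pw_C :: "(nat \<Rightarrow> real) \<Rightarrow> nat \<Rightarrow> nat \<Rightarrow> pwfun set" where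
  "pw_C x k n = {F. (\<forall>i\<le>k. F i \<in> C_on n (piece x i)) \<and> (\<forall>i>k. F i = 0)}"

definition pw_one :: "(nat \<Rightarrow> real) \<Rightarrow> nat \<Rightarrow> pwfun" where
  "pw_one x k = (\<lambda>i. if i \<le> k then const_on (piece x i) 1 else 0)"

definition pw_positive :: "(nat \<Rightarrow> real) \<Rightarrow> nat \<Rightarrow> pwfun \<Rightarrow> bool" where
  "pw_positive x k F \<longleftrightarrow> (\<forall>i\<le>k. \<forall>t\<in>piece x i. F i t > 0)"

definition pw_D :: "(nat \<Rightarrow> real) \<Rightarrow> nat \<Rightarrow> pwfun \<Rightarrow> pwfun" where
  "pw_D x k F = (\<lambda>i. if i \<le> k then deriv_on (piece x i) (F i) else 0)"

text \<open>Matrices of size \<open>m\<close> are functions of two indices in \<open>{0..<m}\<close>.\<close>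

definition connection_matrix :: "nat \<Rightarrow> (nat \<Rightarrow> nat \<Rightarrow> real) \<Rightarrow> bool" where
  "connection_matrix m M \<longleftrightarrow>
     (\<forall>p<m. \<forall>q<m. p < q \<longrightarrow> M p q = 0) \<and>
     (\<forall>p<m. M p p > 0) \<and>
     (\<forall>q<m. M 0 q = (if q = 0 then 1 else 0)) \<and>
     (\<forall>p<m. M p 0 = (if p = 0 then 1 else 0))"

definition spline_space ::
  "nat \<Rightarrow> (nat \<Rightarrow> real) \<Rightarrow> nat \<Rightarrow> (nat \<Rightarrow> (real \<Rightarrow> real) set) \<Rightarrow>
   (nat \<Rightarrow> nat \<Rightarrow> nat \<Rightarrow> real) \<Rightarrow> pwfun set" where
  "spline_space m x k U R = {s \<in> pw_C x k (m - 1). (\<forall>i\<le>k. s i \<in> U i) \<and>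
     (\<forall>i\<in>{1..k}. \<forall>p<m. (pw_D x k ^^ p) s i (x i) =
        (\<Sum>q<m. R i p q * (pw_D x k ^^ q) s (i - 1) (x i)))}"

text \<open>
  An interior knot belongs to two pieces but is counted once. For the spaces of interest the
  multiplicities seen from the two sides coincide, so the maximum below is their common value.
\<close>

definition pw_zero_mult :: "(nat \<Rightarrow> real) \<Rightarrow> nat \<Rightarrow> nat \<Rightarrow> pwfun \<Rightarrow> real \<Rightarrow> nat" where
  "pw_zero_mult x k n F t =
     Max {zero_mult n (piece x i) (F i) t |i. i \<le> k \<and> t \<in> piece x i}"

definition ECP_space :: "(nat \<Rightarrow> real) \<Rightarrow> nat \<Rightarrow> nat \<Rightarrow> pwfun set \<Rightarrow> bool" where
  "ECP_space x k n E \<longleftrightarrow> n \<ge> 1 \<and> subspace E \<and> dim E = n \<and> E \<subseteq> pw_C x k (n - 1) \<and>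
     (\<forall>F\<in>E. F \<noteq> 0 \<longrightarrow>
        total_mult {x 0..x (Suc k)} (pw_zero_mult x k n F) \<le> enat (n - 1))"

definition weight_system :: "(nat \<Rightarrow> real) \<Rightarrow> nat \<Rightarrow> nat \<Rightarrow> (nat \<Rightarrow> pwfun) \<Rightarrow> bool" where
  "weight_system x k n v \<longleftrightarrow> (\<forall>j<n. pw_positive x k (v j) \<and> v j \<in> pw_C x k (n - j - 1))"

primrec gen_deriv :: "(nat \<Rightarrow> real) \<Rightarrow> nat \<Rightarrow> (nat \<Rightarrow> pwfun) \<Rightarrow> nat \<Rightarrow> pwfun \<Rightarrow> pwfun" where
  "gen_deriv x k v 0 F = F / v 0"
| "gen_deriv x k v (Suc j) F = pw_D x k (gen_deriv x k v j F) / v (Suc j)"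

definition is_ECP :: "(nat \<Rightarrow> real) \<Rightarrow> nat \<Rightarrow> nat \<Rightarrow> (nat \<Rightarrow> pwfun) \<Rightarrow> pwfun set \<Rightarrow> bool" where
  "is_ECP x k n v E \<longleftrightarrow> weight_system x k n v \<and> ECP_space x k n E \<and>
     E = {F \<in> pw_C x k (n - 1).
       (\<exists>c. \<forall>i\<le>k. \<forall>t\<in>piece x i. gen_deriv x k v (n - 1) F i t = c) \<and>
       (\<forall>i\<in>{1..k}. \<forall>j<n. gen_deriv x k v j F i (x i) = gen_deriv x k v j F (i - 1) (x i))}"

definition transition_functions ::
  "nat \<Rightarrow> (nat \<Rightarrow> real) \<Rightarrow> nat \<Rightarrow> pwfun set \<Rightarrow> (nat \<Rightarrow> pwfun) \<Rightarrow> bool" where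
  "transition_functions m x k S g \<longleftrightarrow>
     (\<forall>l\<in>{1..m}. g l \<in> S) \<and> g 1 = pw_one x k \<and>
     (\<forall>l\<in>{2..m}.
        (\<forall>r\<le>l - 2. (pw_D x k ^^ r) (g l) 0 (x 0) = 0) \<and>
        (\<forall>r\<le>m - l. (pw_D x k ^^ r) (g l) k (x (Suc k)) = (if r = 0 then 1 else 0)))"

end

theory Submission
  imports Defs
begin

text \<open>
  Differentiation and division by a positive weight, \<open>F \<mapsto> DF / w\<close>, is iterated on the whole
  space, not only on the transition functions. Put \<open>E 0 = S\<close> and let \<open>E j\<close> be the image of
  \<open>E (j - 1)\<close> under \<open>F \<mapsto> DF / w j\<close>. The recursion keeps four things true (\<open>recursion_step\<close>).
  The functions \<open>f l (m - j)\<close> span \<open>E j\<close>; the first of them is the constant \<open>1\<close>; the elements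
  of \<open>E j\<close> have \<open>m - 1 - j\<close> continuous derivatives on each piece; and at each knot, an element
  of \<open>E j\<close> has a zero of order \<open>r \<le> m - j\<close> from the left if and only if it has one from the right.
  The last property replaces the connection matrices. It comes from their triangular shape
  (\<open>spline_space_matched\<close>), passes from \<open>F - F(x\<^sub>i)\<close> to \<open>DF / w\<close> (\<open>knot_matched_D_divide\<close>), and in a
  space with constants it implies continuity at the knots (\<open>knot_matched_imp_continuous\<close>). So all
  the \<open>E j\<close> consist of continuous functions, and after \<open>m - 1\<close> steps only constants are left.

  Such a chain of spaces has the ECP property at every level (\<open>is_ECP_level\<close>). Since both \<open>F\<close> and
  \<open>DF / w\<close> are continuous and \<open>w\<close> is positive, Rolle's theorem holds across the knots
  (\<open>pw_rolle\<close>), so each step up the chain gains at most one zero, counted with multiplicity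
  (\<open>zero_count_step\<close>). Conversely, a piecewise function whose generalized derivatives are
  continuous and end in a constant is recovered from that constant by climbing the chain: two
  functions with equal derivatives differ by a constant, and constants are in every space
  (\<open>antiderivative_in_E\<close>). Level \<open>0\<close> gives the claim for \<open>S\<close>, and level \<open>1\<close>, multiplied by \<open>w 1\<close>,
  the claim for \<open>DS\<close>.

  The start of the recursion, that the transition functions span \<open>S\<close>, rests on the EC-spaces on
  the pieces: a spline that vanishes on the first piece vanishes everywhere, so the dimension of
  \<open>S\<close> is at most \<open>m\<close>.
\<close>

section \<open>Smooth functions on a compact interval\<close>

lemma scaleR_fun_apply [simp]: "(c *\<^sub>R f) t = c *\<^sub>R f t"
  by (simp add: scaleR_fun_def)

lemma const_on_apply: "t \<in> J \<Longrightarrow> const_on J c t = c"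
  by (simp add: const_on_def)

lemma deriv_on_outside: "t \<notin> J \<Longrightarrow> deriv_on J f t = 0"
  by (simp add: deriv_on_def)

lemma deriv_on_unique:
  assumes "a < b" "t \<in> {a..b}" "(f has_real_derivative d) (at t within {a..b})"
  shows "deriv_on {a..b} f t = d"
  using assms vector_derivative_within_closed_interval[of a b t f d]
  by (simp add: deriv_on_def has_real_derivative_iff_has_vector_derivative)

lemma has_derivative_deriv_on:
  assumes "a < b" "f differentiable_on {a..b}" "t \<in> {a..b}"
  shows "(f has_real_derivative deriv_on {a..b} f t) (at t within {a..b})"
proof -
  from assms obtain d where "(f has_real_derivative d) (at t within {a..b})"
    unfolding differentiable_on_def real_differentiable_def by blast
  with deriv_on_unique[OF assms(1,3) this] show ?thesis by simp
qed

text \<open>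
  The common pattern of all differentiation rules below: on the interval the derivative
  is computed pointwise, and outside it both sides are zero by convention.
\<close>

lemma deriv_on_eqI:
  assumes "a < b" "\<And>t. t \<notin> {a..b} \<Longrightarrow> d t = 0"
    and "\<And>t. t \<in> {a..b} \<Longrightarrow> (f has_real_derivative d t) (at t within {a..b})"
  shows "f differentiable_on {a..b}" and "deriv_on {a..b} f = d"
proof -
  show "f differentiable_on {a..b}"
    using assms(3) unfolding differentiable_on_def real_differentiable_def by blast
  show "deriv_on {a..b} f = d"
    using deriv_on_unique[OF assms(1) _ assms(3)] assms(2) by (auto simp: deriv_on_def)
qed

lemma C_on_0: "f \<in> C_on 0 J \<longleftrightarrow> (\<forall>t. t \<notin> J \<longrightarrow> f t = 0) \<and> continuous_on J f"
  by (simp add: C_on_def)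

text \<open>
  Peeling off the first derivative instead of the last makes every closure property of
  \<^const>\<open>C_on\<close> below an induction on the order of smoothness.
\<close>

lemma C_on_Suc:
  "f \<in> C_on (Suc n) J \<longleftrightarrow>
     (\<forall>t. t \<notin> J \<longrightarrow> f t = 0) \<and> f differentiable_on J \<and> deriv_on J f \<in> C_on n J"
  by (auto simp: C_on_def All_less_Suc2 funpow_Suc_right deriv_on_outside simp del: funpow.simps(2))

lemma C_on_outside: "f \<in> C_on n J \<Longrightarrow> t \<notin> J \<Longrightarrow> f t = 0"
  by (simp add: C_on_def)

lemma C_on_SucD: "f \<in> C_on (Suc n) J \<Longrightarrow> f \<in> C_on n J"
proof (induction n arbitrary: f)
  case 0
  then show ?case by (auto simp: C_on_0 C_on_Suc[of f 0] differentiable_imp_continuous_on)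
next
  case (Suc n)
  then show ?case by (simp add: C_on_Suc[of _ "Suc n"] C_on_Suc[of _ n])
qed

lemma C_on_mono:
  assumes "f \<in> C_on n J" "p \<le> n"
  shows "f \<in> C_on p J"
  using assms(2,1) by (induction rule: inc_induct) (auto intro: C_on_SucD)

lemma C_on_continuous: "f \<in> C_on n J \<Longrightarrow> continuous_on J f"
  using C_on_mono[of f n J 0] by (simp add: C_on_0)

lemma C_on_has_derivative:
  assumes "a < b" "f \<in> C_on (Suc n) {a..b}" "t \<in> {a..b}"
  shows "(f has_real_derivative deriv_on {a..b} f t) (at t within {a..b})"
  using assms by (intro has_derivative_deriv_on) (auto simp: C_on_Suc)

lemma deriv_on_add:
  assumes "a < b" "f \<in> C_on (Suc n) {a..b}" "g \<in> C_on (Suc n) {a..b}"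
  shows "f + g differentiable_on {a..b}"
    and "deriv_on {a..b} (f + g) = deriv_on {a..b} f + deriv_on {a..b} g"
proof -
  have *: "(f + g has_real_derivative (deriv_on {a..b} f + deriv_on {a..b} g) t) (at t within {a..b})"
    if "t \<in> {a..b}" for t
    using DERIV_add[OF C_on_has_derivative[OF assms(1,2) that] C_on_has_derivative[OF assms(1,3) that]]
    by (simp add: plus_fun_def)
  show "f + g differentiable_on {a..b}"
    and "deriv_on {a..b} (f + g) = deriv_on {a..b} f + deriv_on {a..b} g"
    using deriv_on_eqI[OF assms(1) _ *] by (auto simp: deriv_on_outside)
qed

lemma deriv_on_scaleR:
  assumes "a < b" "f \<in> C_on (Suc n) {a..b}"
  shows "c *\<^sub>R f differentiable_on {a..b}"
    and "deriv_on {a..b} (c *\<^sub>R f) = c *\<^sub>R deriv_on {a..b} f"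
proof -
  have *: "(c *\<^sub>R f has_real_derivative (c *\<^sub>R deriv_on {a..b} f) t) (at t within {a..b})"
    if "t \<in> {a..b}" for t
    using DERIV_cmult[OF C_on_has_derivative[OF assms(1,2) that], of c]
    by (simp add: scaleR_fun_def)
  show "c *\<^sub>R f differentiable_on {a..b}"
    and "deriv_on {a..b} (c *\<^sub>R f) = c *\<^sub>R deriv_on {a..b} f"
    using deriv_on_eqI[OF assms(1) _ *] by (auto simp: deriv_on_outside)
qed

lemma deriv_on_mult:
  assumes "a < b" "f \<in> C_on (Suc n) {a..b}" "g \<in> C_on (Suc p) {a..b}"
  shows "f * g differentiable_on {a..b}"
    and "deriv_on {a..b} (f * g) = deriv_on {a..b} f * g + f * deriv_on {a..b} g"
proof -
  have *: "(f * g has_real_derivative (deriv_on {a..b} f * g + f * deriv_on {a..b} g) t)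
      (at t within {a..b})" if "t \<in> {a..b}" for t
    using DERIV_mult[OF C_on_has_derivative[OF assms(1,2) that] C_on_has_derivative[OF assms(1,3) that]]
    by (simp add: times_fun_def algebra_simps)
  show "f * g differentiable_on {a..b}"
    and "deriv_on {a..b} (f * g) = deriv_on {a..b} f * g + f * deriv_on {a..b} g"
    using deriv_on_eqI[OF assms(1) _ *] by (auto simp: deriv_on_outside C_on_outside[OF assms(2)])
qed

lemma deriv_on_inverse:
  assumes "a < b" "f \<in> C_on (Suc n) {a..b}" "\<forall>t\<in>{a..b}. f t \<noteq> 0"
  shows "inverse f differentiable_on {a..b}"
    and "deriv_on {a..b} (inverse f) = (- 1) *\<^sub>R (deriv_on {a..b} f * (inverse f * inverse f))"
proof -
  have *: "(inverse f has_real_derivative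
      ((- 1) *\<^sub>R (deriv_on {a..b} f * (inverse f * inverse f))) t) (at t within {a..b})"
    if "t \<in> {a..b}" for t
    using DERIV_inverse'[OF C_on_has_derivative[OF assms(1,2) that]] assms(3) that
    by (simp add: inverse_fun_def comp_def mult_ac)
  show "inverse f differentiable_on {a..b}"
    and "deriv_on {a..b} (inverse f) = (- 1) *\<^sub>R (deriv_on {a..b} f * (inverse f * inverse f))"
    using deriv_on_eqI[OF assms(1) _ *] by (auto simp: deriv_on_outside)
qed

lemma C_on_add:
  assumes "a < b"
  shows "f \<in> C_on n {a..b} \<Longrightarrow> g \<in> C_on n {a..b} \<Longrightarrow> f + g \<in> C_on n {a..b}"
proof (induction n arbitrary: f g)
  case 0
  then show ?case by (auto simp: C_on_0 plus_fun_def intro: continuous_on_add)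
next
  case (Suc n)
  show ?case unfolding C_on_Suc[of "f + g"]
    using deriv_on_add[OF assms Suc.prems] Suc.prems by (auto simp: C_on_Suc[of _ n] intro: Suc.IH)
qed

lemma C_on_scaleR:
  assumes "a < b"
  shows "f \<in> C_on n {a..b} \<Longrightarrow> c *\<^sub>R f \<in> C_on n {a..b}"
proof (induction n arbitrary: f)
  case 0
  then show ?case by (auto simp: C_on_0 scaleR_fun_def intro: continuous_intros)
next
  case (Suc n)
  show ?case unfolding C_on_Suc[of "c *\<^sub>R f"]
    using deriv_on_scaleR[OF assms Suc.prems] Suc.prems by (auto simp: C_on_Suc[of _ n] intro: Suc.IH)
qed

lemma C_on_mult:
  assumes "a < b"
  shows "f \<in> C_on n {a..b} \<Longrightarrow> g \<in> C_on n {a..b} \<Longrightarrow> f * g \<in> C_on n {a..b}"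
proof (induction n arbitrary: f g)
  case 0
  then show ?case by (auto simp: C_on_0 times_fun_def intro: continuous_on_mult)
next
  case (Suc n)
  have "f \<in> C_on n {a..b}" "g \<in> C_on n {a..b}" using Suc.prems by (auto intro: C_on_SucD)
  then have "deriv_on {a..b} f * g + f * deriv_on {a..b} g \<in> C_on n {a..b}"
    using Suc.prems by (intro C_on_add[OF assms] Suc.IH) (auto simp: C_on_Suc[of _ n])
  then show ?case unfolding C_on_Suc[of "f * g"]
    using deriv_on_mult[OF assms Suc.prems] Suc.prems by (auto simp: C_on_Suc[of _ n])
qed

lemma C_on_inverse:
  assumes "a < b" "\<forall>t\<in>{a..b}. f t \<noteq> 0"
  shows "f \<in> C_on n {a..b} \<Longrightarrow> inverse f \<in> C_on n {a..b}"
proof (induction n)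
  case 0
  then show ?case using assms
    by (auto simp: C_on_0 inverse_fun_def comp_def intro!: continuous_on_inverse)
next
  case (Suc n)
  have "inverse f \<in> C_on n {a..b}" using Suc.IH C_on_SucD[OF Suc.prems] .
  then have "(- 1) *\<^sub>R (deriv_on {a..b} f * (inverse f * inverse f)) \<in> C_on n {a..b}"
    using Suc.prems by (intro C_on_scaleR C_on_mult assms(1)) (auto simp: C_on_Suc[of _ n])
  then show ?case unfolding C_on_Suc[of "inverse f"]
    using deriv_on_inverse[OF assms(1) Suc.prems assms(2)] Suc.prems by (auto simp: C_on_Suc[of _ n])
qed

lemma C_on_divide:
  assumes "a < b" "\<forall>t\<in>{a..b}. g t \<noteq> 0" "f \<in> C_on n {a..b}" "g \<in> C_on n {a..b}"
  shows "f / g \<in> C_on n {a..b}"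
proof -
  have "f / g = f * inverse g" by (simp add: fun_eq_iff divide_inverse)
  then show ?thesis using C_on_mult C_on_inverse assms by metis
qed

lemma deriv_on_const:
  assumes "a < b"
  shows "const_on {a..b} c differentiable_on {a..b}"
    and "deriv_on {a..b} (const_on {a..b} c) = 0"
proof -
  have *: "(const_on {a..b} c has_real_derivative 0 t) (at t within {a..b})" if "t \<in> {a..b}" for t
    by (rule has_field_derivative_transform_within[where f = "\<lambda>_. c" and d = 1])
       (use that in \<open>auto simp: const_on_def\<close>)
  show "const_on {a..b} c differentiable_on {a..b}"
    and "deriv_on {a..b} (const_on {a..b} c) = 0"
    using deriv_on_eqI[OF assms _ *] by auto
qed

lemma const_on_C_on:
  assumes "a < b"
  shows "const_on {a..b} c \<in> C_on n {a..b}"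
proof (induction n arbitrary: c)
  case 0
  have "continuous_on {a..b} (const_on {a..b} c)"
    by (rule continuous_on_eq[of _ "\<lambda>_. c"]) (auto simp: const_on_def)
  then show ?case by (simp add: C_on_0 const_on_def)
next
  case (Suc n)
  have "0 = const_on {a..b} 0" by (auto simp: const_on_def)
  then have "deriv_on {a..b} (const_on {a..b} c) \<in> C_on n {a..b}"
    using Suc.IH[of 0] deriv_on_const(2)[OF assms] by metis
  then show ?case
    using deriv_on_const(1)[OF assms] by (simp add: C_on_Suc) (simp add: const_on_def)
qed

lemma deriv_on_zero_imp_const:
  assumes "a < b" "f \<in> C_on (Suc n) {a..b}" "deriv_on {a..b} f = 0"
  shows "f = const_on {a..b} (f a)"
proof -
  have "\<exists>c. \<forall>t\<in>{a..b}. f t = c"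
    using has_field_derivative_zero_constant[of "{a..b}" f] C_on_has_derivative[OF assms(1,2)] assms(3)
    by auto
  then show ?thesis using assms(1) C_on_outside[OF assms(2)] by (force simp: const_on_def)
qed

section \<open>Orders of vanishing\<close>

text \<open>
  A zero of multiplicity at least \<open>r\<close>. Unlike \<^const>\<open>zero_mult\<close> it has no cap and recurses
  along the derivative, which is what inductive arguments need; \<open>zero_mult_props\<close> translates.
\<close>

definition vanishes :: "nat \<Rightarrow> real set \<Rightarrow> (real \<Rightarrow> real) \<Rightarrow> real \<Rightarrow> bool" where
  "vanishes r J f t \<longleftrightarrow> (\<forall>q<r. (deriv_on J ^^ q) f t = 0)"

lemma vanishes_0 [simp]: "vanishes 0 J f t"
  by (simp add: vanishes_def)

lemma vanishes_Suc: "vanishes (Suc r) J f t \<longleftrightarrow> f t = 0 \<and> vanishes r J (deriv_on J f) t"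
  by (simp add: vanishes_def All_less_Suc2 funpow_Suc_right del: funpow.simps(2))

lemma vanishes_mono: "vanishes r J f t \<Longrightarrow> p \<le> r \<Longrightarrow> vanishes p J f t"
  by (simp add: vanishes_def)

lemma vanishes_add:
  assumes "a < b"
  shows "vanishes r {a..b} f t \<Longrightarrow> vanishes r {a..b} g t \<Longrightarrow> f \<in> C_on (r - 1) {a..b} \<Longrightarrow>
    g \<in> C_on (r - 1) {a..b} \<Longrightarrow> vanishes r {a..b} (f + g) t"
proof (induction r arbitrary: f g)
  case (Suc r)
  show ?case
  proof (cases r)
    case 0
    then show ?thesis using Suc.prems by (simp add: vanishes_Suc)
  next
    case (Suc r')
    with Suc.prems have "f \<in> C_on (Suc r') {a..b}" "g \<in> C_on (Suc r') {a..b}" by auto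
    moreover from this Suc.prems Suc
    have "vanishes r {a..b} (deriv_on {a..b} f + deriv_on {a..b} g) t"
      by (intro Suc.IH) (auto simp: vanishes_Suc[of "Suc r'"] C_on_Suc[of _ r'])
    ultimately show ?thesis
      using Suc.prems(1,2) deriv_on_add(2)[OF assms, of f r' g] unfolding vanishes_Suc[of r] by simp
  qed
qed simp

lemma vanishes_mult:
  assumes "a < b"
  shows "vanishes r {a..b} f t \<Longrightarrow> f \<in> C_on (r - 1) {a..b} \<Longrightarrow>
    g \<in> C_on (r - 1) {a..b} \<Longrightarrow> vanishes r {a..b} (f * g) t"
proof (induction r arbitrary: f g)
  case (Suc r)
  show ?case
  proof (cases r)
    case 0
    then show ?thesis using Suc.prems by (simp add: vanishes_Suc)
  next
    case (Suc r')
    with Suc.prems have C: "f \<in> C_on (Suc r') {a..b}" "g \<in> C_on (Suc r') {a..b}" by auto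
    note C' = C[THEN C_on_SucD]
    have f': "deriv_on {a..b} f \<in> C_on r' {a..b}" "deriv_on {a..b} g \<in> C_on r' {a..b}"
      using C by (auto simp: C_on_Suc)
    have "vanishes r {a..b} (deriv_on {a..b} f * g) t"
      using Suc.prems(1) f' C' Suc by (intro Suc.IH) (auto simp: vanishes_Suc[of "Suc r'"])
    moreover have "vanishes r {a..b} (f * deriv_on {a..b} g) t"
      using vanishes_mono[OF Suc.prems(1), of r] f' C' Suc by (intro Suc.IH) auto
    ultimately have "vanishes r {a..b} (deriv_on {a..b} f * g + f * deriv_on {a..b} g) t"
      using f' C' Suc by (intro vanishes_add[OF assms]) (auto intro!: C_on_mult[OF assms])
    with Suc.prems(1) deriv_on_mult(2)[OF assms C] show ?thesis unfolding vanishes_Suc[of r] by simp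
  qed
qed simp

text \<open>
  Dividing by a zero-free function is undone by multiplying with it, and by Leibniz' rule
  (\<open>vanishes_mult\<close>) neither operation lowers the order of a zero. So passing from \<open>DF\<close> to
  \<open>DF / w\<close> leaves multiplicities alone.
\<close>

lemma vanishes_divide_iff:
  assumes "a < b" "\<forall>t\<in>{a..b}. g t \<noteq> 0" "f \<in> C_on n {a..b}" "g \<in> C_on n {a..b}" "r \<le> Suc n"
  shows "vanishes r {a..b} (f / g) t \<longleftrightarrow> vanishes r {a..b} f t"
proof -
  have le: "r - 1 \<le> n" using assms(5) by simp
  have C: "f \<in> C_on (r - 1) {a..b}" "g \<in> C_on (r - 1) {a..b}"
    using assms(3,4) C_on_mono le by blast+
  have 1: "f / g = f * inverse g" by (simp add: fun_eq_iff divide_inverse)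
  have 2: "f = (f / g) * g"
    using assms(2) C_on_outside[OF assms(3)] by (force simp: fun_eq_iff)
  show ?thesis
    using vanishes_mult[OF assms(1) _ C(1) C_on_inverse[OF assms(1,2) C(2)]]
      vanishes_mult[OF assms(1) _ C_on_divide[OF assms(1,2) C] C(2)] 1 2 by metis
qed

lemma zero_mult_props:
  shows zero_mult_le: "zero_mult n J f t \<le> n"
    and vanishes_zero_mult: "vanishes (zero_mult n J f t) J f t"
    and zero_mult_ge: "r \<le> n \<Longrightarrow> vanishes r J f t \<Longrightarrow> r \<le> zero_mult n J f t"
proof -
  let ?R = "{r. r \<le> n \<and> (\<forall>q<r. (deriv_on J ^^ q) f t = 0)}"
  have fin: "finite ?R" by simp
  have "0 \<in> ?R" by simp
  then have "zero_mult n J f t \<in> ?R"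
    unfolding zero_mult_def using Max_in[OF fin] by blast
  then show "zero_mult n J f t \<le> n" "vanishes (zero_mult n J f t) J f t"
    by (auto simp: vanishes_def)
  show "r \<le> n \<Longrightarrow> vanishes r J f t \<Longrightarrow> r \<le> zero_mult n J f t"
    unfolding zero_mult_def using Max_ge[OF fin, of r] by (simp add: vanishes_def)
qed

section \<open>Extrema, interlacing and counting\<close>

text \<open>
  Only one side of \<open>\<xi>\<close> is needed for each sign. At a knot the function seen from the left and
  from the right has two different one-sided derivatives, and each conclusion is applied to
  its own piece.
\<close>

lemma has_derivative_at_max_sign:
  fixes f :: "real \<Rightarrow> real"
  assumes "(f has_real_derivative d) (at \<xi> within {a..b})" "\<alpha> < \<xi>" "\<xi> < \<beta>"
    and "\<And>t. t \<in> {a..b} \<Longrightarrow> \<alpha> < t \<Longrightarrow> t < \<beta> \<Longrightarrow> f t \<le> f \<xi>"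
  shows "a < \<xi> \<Longrightarrow> \<xi> \<le> b \<Longrightarrow> 0 \<le> d" and "a \<le> \<xi> \<Longrightarrow> \<xi> < b \<Longrightarrow> d \<le> 0"
proof -
  show "0 \<le> d" if "a < \<xi>" "\<xi> \<le> b"
  proof (rule ccontr)
    assume "\<not> 0 \<le> d"
    then obtain \<delta> where \<delta>: "\<delta> > 0" "\<And>h. h > 0 \<Longrightarrow> \<xi> - h \<in> {a..b} \<Longrightarrow> h < \<delta> \<Longrightarrow> f \<xi> < f (\<xi> - h)"
      using has_real_derivative_neg_dec_left[OF assms(1)] by (metis not_le)
    define h where "h = min (\<delta> / 2) (min ((\<xi> - a) / 2) ((\<xi> - \<alpha>) / 2))"
    have "h > 0" "h < \<delta>" "\<xi> - h \<in> {a..b}" "\<alpha> < \<xi> - h" "\<xi> - h < \<beta>"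
      using that assms \<delta>(1) by (auto simp: h_def min_def field_simps)
    then show False using \<delta>(2)[of h] assms(4)[of "\<xi> - h"] by auto
  qed
  show "d \<le> 0" if "a \<le> \<xi>" "\<xi> < b"
  proof (rule ccontr)
    assume "\<not> d \<le> 0"
    then obtain \<delta> where \<delta>: "\<delta> > 0" "\<And>h. h > 0 \<Longrightarrow> \<xi> + h \<in> {a..b} \<Longrightarrow> h < \<delta> \<Longrightarrow> f \<xi> < f (\<xi> + h)"
      using has_real_derivative_pos_inc_right[OF assms(1)] by (metis not_le)
    define h where "h = min (\<delta> / 2) (min ((b - \<xi>) / 2) ((\<beta> - \<xi>) / 2))"
    have "h > 0" "h < \<delta>" "\<xi> + h \<in> {a..b}" "\<alpha> < \<xi> + h" "\<xi> + h < \<beta>"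
      using that assms \<delta>(1) by (auto simp: h_def min_def field_simps)
    then show False using \<delta>(2)[of h] assms(4)[of "\<xi> + h"] by auto
  qed
qed

text \<open>
  The points \<open>C\<close> must avoid \<open>A\<close>, because multiplicities of a derivative at old zeros and its
  new simple zeros are added up later; picking one point between neighbours, from left to
  right, achieves this.
\<close>

lemma interlacing_points:
  fixes A :: "real set"
  assumes "finite A" "A \<noteq> {}"
    and "\<And>\<alpha> \<beta>. \<alpha> \<in> A \<Longrightarrow> \<beta> \<in> A \<Longrightarrow> \<alpha> < \<beta> \<Longrightarrow> \<exists>\<xi>. \<alpha> < \<xi> \<and> \<xi> < \<beta> \<and> P \<xi>"
  shows "\<exists>C. finite C \<and> Suc (card C) = card A \<and> C \<inter> A = {} \<and>
    (\<forall>c\<in>C. P c \<and> Min A < c \<and> c < Max A)"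
  using assms
proof (induction A rule: finite_linorder_max_induct)
  case (insert b A)
  show ?case
  proof (cases "A = {}")
    case True
    then show ?thesis by (intro exI[of _ "{}"]) auto
  next
    case False
    then obtain C where C: "finite C" "Suc (card C) = card A" "C \<inter> A = {}"
      "\<forall>c\<in>C. P c \<and> Min A < c \<and> c < Max A"
      using insert.IH insert.prems by auto
    have max: "Max A \<in> A" "Max A < b" using False insert.hyps by auto
    then obtain \<xi> where \<xi>: "Max A < \<xi>" "\<xi> < b" "P \<xi>" using insert.prems(2)[of "Max A" b] by auto
    have "Min A \<le> Max A" "Min A \<in> A" using False insert.hyps(1) by auto
    then have m: "Min (insert b A) = Min A" "Max (insert b A) = b"
      using False insert.hyps(1) max by auto
    have "b \<notin> A" using insert.hyps by auto
    moreover have "\<xi> \<notin> C" using C(4) \<xi>(1) by auto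
    moreover have "\<xi> \<notin> A" using \<xi>(1) Max_ge[OF insert.hyps(1), of \<xi>] by auto
    moreover have "b \<notin> C" using C(4) max by auto
    moreover have "Min A < \<xi>" using \<open>Min A \<le> Max A\<close> \<xi>(1) by (rule le_less_trans)
    ultimately show ?thesis using C \<xi> insert.hyps(1) max unfolding m
      by (intro exI[of _ "insert \<xi> C"]) auto
  qed
qed simp

text \<open>
  Bounding all finite partial counts also excludes infinitely many zeros, so the counting
  arguments can stay with finite sums and never meet the value \<open>\<infinity>\<close>.
\<close>

lemma total_mult_le:
  assumes "\<And>A. finite A \<Longrightarrow> A \<subseteq> J \<Longrightarrow> (\<Sum>t\<in>A. \<mu> t) \<le> n"
  shows "total_mult J \<mu> \<le> enat n"
proof -
  let ?T = "{t \<in> J. \<mu> t \<noteq> 0}"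
  have "finite ?T"
  proof (rule ccontr)
    assume "infinite ?T"
    then obtain A where A: "finite A" "card A = Suc n" "A \<subseteq> ?T"
      using infinite_arbitrarily_large by blast
    have "card A = (\<Sum>t\<in>A. 1)" by simp
    also have "\<dots> \<le> (\<Sum>t\<in>A. \<mu> t)" using A(3) by (intro sum_mono) force
    also have "\<dots> \<le> n" using A by (intro assms) auto
    finally show False using A(2) by simp
  qed
  then show ?thesis using assms[of ?T] by (auto simp: total_mult_def)
qed

section \<open>Piecewise smooth functions\<close>

locale partition =
  fixes x :: "nat \<Rightarrow> real" and k :: nat
  assumes knots_increasing: "i \<le> k \<Longrightarrow> x i < x (Suc i)"
begin

lemma knots_less: "i < j \<Longrightarrow> j \<le> Suc k \<Longrightarrow> x i < x j"
proof (induction j)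
  case (Suc j)
  then show ?case using knots_increasing[of j] by (cases "i = j") auto
qed simp

lemma knots_le: "i \<le> j \<Longrightarrow> j \<le> Suc k \<Longrightarrow> x i \<le> x j"
  using knots_less[of i j] by (cases "i = j") auto

lemma piece_subset: "i \<le> k \<Longrightarrow> piece x i \<subseteq> {x 0..x (Suc k)}"
  using knots_le[of 0 i] knots_le[of "Suc i" "Suc k"] by (auto simp: piece_def)

lemma piece_left:
  assumes "x 0 < t" "t \<le> x (Suc k)"
  obtains i where "i \<le> k" "x i < t" "t \<le> x (Suc i)"
proof -
  define l where "l = (LEAST i. t \<le> x (Suc i))"
  have l: "t \<le> x (Suc l)" "l \<le> k"
    using assms(2) unfolding l_def by (auto intro: LeastI Least_le)
  have "x l < t"
  proof (cases l)
    case (Suc p)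
    then have "\<not> t \<le> x (Suc p)" using not_less_Least[of p "\<lambda>i. t \<le> x (Suc i)"] unfolding l_def by simp
    then show ?thesis using Suc by simp
  qed (use assms in simp)
  with l show thesis using that by blast
qed

lemma piece_right:
  assumes "x 0 \<le> t" "t < x (Suc k)"
  obtains i where "i \<le> k" "x i \<le> t" "t < x (Suc i)"
proof -
  define l where "l = (LEAST i. t < x (Suc i))"
  have l: "t < x (Suc l)" "l \<le> k"
    using assms(2) unfolding l_def by (auto intro: LeastI Least_le)
  have "x l \<le> t"
  proof (cases l)
    case (Suc p)
    then have "\<not> t < x (Suc p)" using not_less_Least[of p "\<lambda>i. t < x (Suc i)"] unfolding l_def by simp
    then show ?thesis using Suc by simp
  qed (use assms in simp)
  with l show thesis using that by blast
qed

lemma piece_cover: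
  assumes "t \<in> {x 0..x (Suc k)}"
  obtains i where "i \<le> k" "t \<in> piece x i"
proof (cases "t = x 0")
  case True
  then have "t \<in> piece x 0" using knots_increasing[of 0] by (simp add: piece_def)
  then show thesis by (rule that[of 0, rotated]) simp
next
  case False
  with assms have "x 0 < t" "t \<le> x (Suc k)" by auto
  then obtain i where "i \<le> k" "x i < t" "t \<le> x (Suc i)" by (rule piece_left)
  then show thesis by (intro that[of i]) (auto simp: piece_def)
qed

lemma Union_pieces: "{x 0..x (Suc k)} = (\<Union>i\<in>{..k}. piece x i)"
proof
  show "{x 0..x (Suc k)} \<subseteq> (\<Union>i\<in>{..k}. piece x i)"
  proof
    fix t assume "t \<in> {x 0..x (Suc k)}"
    then obtain i where "i \<le> k" "t \<in> piece x i" by (rule piece_cover)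
    then show "t \<in> (\<Union>i\<in>{..k}. piece x i)" by auto
  qed
  show "(\<Union>i\<in>{..k}. piece x i) \<subseteq> {x 0..x (Suc k)}"
    by (intro UN_least piece_subset) simp
qed

lemma pw_C_D: "F \<in> pw_C x k n \<Longrightarrow> i \<le> k \<Longrightarrow> F i \<in> C_on n {x i..x (Suc i)}"
  by (simp add: pw_C_def piece_def)

lemma pw_C_outside: "F \<in> pw_C x k n \<Longrightarrow> \<not> (i \<le> k \<and> t \<in> piece x i) \<Longrightarrow> F i t = 0"
  by (cases "i \<le> k") (auto simp: pw_C_def C_on_outside)

text \<open>
  Components beyond the last piece and values outside the pieces are zero on both sides.
\<close>

lemma pw_eqI:
  assumes "F \<in> pw_C x k n" "G \<in> pw_C x k p"
    and "\<And>i t. i \<le> k \<Longrightarrow> t \<in> piece x i \<Longrightarrow> F i t = G i t"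
  shows "F = G"
proof (intro ext)
  show "F i t = G i t" for i t
    using assms pw_C_outside[of F n i t] pw_C_outside[of G p i t] by (cases "i \<le> k \<and> t \<in> piece x i") auto
qed

lemma pw_C_mono: "F \<in> pw_C x k n \<Longrightarrow> p \<le> n \<Longrightarrow> F \<in> pw_C x k p"
  by (auto simp: pw_C_def intro: C_on_mono)

lemma pw_C_add: "F \<in> pw_C x k n \<Longrightarrow> G \<in> pw_C x k n \<Longrightarrow> F + G \<in> pw_C x k n"
  using knots_increasing by (auto simp: pw_C_def piece_def intro: C_on_add)

lemma pw_C_scaleR: "F \<in> pw_C x k n \<Longrightarrow> c *\<^sub>R F \<in> pw_C x k n"
  using knots_increasing by (auto simp: pw_C_def piece_def intro: C_on_scaleR)

lemma pw_C_zero: "0 \<in> pw_C x k n"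
proof -
  have "const_on {x i..x (Suc i)} 0 = 0" for i by (auto simp: const_on_def)
  then show ?thesis using const_on_C_on[OF knots_increasing, of _ 0 n] by (auto simp: pw_C_def piece_def)
qed

lemma subspace_pw_C: "subspace (pw_C x k n)"
  by (auto simp: subspace_def pw_C_add pw_C_scaleR pw_C_zero)

lemma pw_one_C: "pw_one x k \<in> pw_C x k n"
  using knots_increasing by (auto simp: pw_C_def pw_one_def piece_def intro: const_on_C_on)

lemma pw_C_divide:
  assumes "F \<in> pw_C x k n" "W \<in> pw_C x k n" "pw_positive x k W"
  shows "F / W \<in> pw_C x k n"
proof -
  have "F i / W i \<in> C_on n (piece x i)" if "i \<le> k" for i
  proof -
    have "\<forall>t\<in>{x i..x (Suc i)}. W i t \<noteq> 0"
      using assms(3) that unfolding pw_positive_def piece_def by (metis less_irrefl)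
    then show ?thesis
      using C_on_divide knots_increasing[OF that] pw_C_D[OF assms(1) that] pw_C_D[OF assms(2) that]
      unfolding piece_def by blast
  qed
  moreover have "F i / W i = 0" if "i > k" for i
    using that assms(1) by (auto simp: pw_C_def fun_eq_iff)
  ultimately show ?thesis by (simp add: pw_C_def)
qed

lemma pw_D_apply: "i \<le> k \<Longrightarrow> pw_D x k F i = deriv_on {x i..x (Suc i)} (F i)"
  by (simp add: pw_D_def piece_def)

lemma pw_D_C: "F \<in> pw_C x k (Suc n) \<Longrightarrow> pw_D x k F \<in> pw_C x k n"
  by (auto simp: pw_C_def pw_D_def C_on_Suc)

lemma pw_D_add:
  assumes "F \<in> pw_C x k (Suc n)" "G \<in> pw_C x k (Suc n)"
  shows "pw_D x k (F + G) = pw_D x k F + pw_D x k G"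
proof
  show "pw_D x k (F + G) i = (pw_D x k F + pw_D x k G) i" for i
    using deriv_on_add(2)[OF knots_increasing pw_C_D[OF assms(1)] pw_C_D[OF assms(2)]]
    by (cases "i \<le> k") (simp_all add: pw_D_def piece_def)
qed

lemma pw_D_scaleR:
  assumes "F \<in> pw_C x k (Suc n)"
  shows "pw_D x k (c *\<^sub>R F) = c *\<^sub>R pw_D x k F"
proof
  show "pw_D x k (c *\<^sub>R F) i = (c *\<^sub>R pw_D x k F) i" for i
    using deriv_on_scaleR(2)[OF knots_increasing pw_C_D[OF assms]]
    by (cases "i \<le> k") (simp_all add: pw_D_def piece_def)
qed

lemma pw_D_one: "pw_D x k (pw_one x k) = 0"
proof
  show "pw_D x k (pw_one x k) i = 0 i" for i
    using deriv_on_const(2)[OF knots_increasing] by (cases "i \<le> k") (simp_all add: pw_D_def pw_one_def piece_def)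
qed

lemma pw_D_diff_const:
  assumes "F \<in> pw_C x k (Suc n)"
  shows "pw_D x k (F - c *\<^sub>R pw_one x k) = pw_D x k F"
proof -
  have "F - c *\<^sub>R pw_one x k = F + (- c) *\<^sub>R pw_one x k" by simp
  then show ?thesis
    using pw_D_add[OF assms pw_C_scaleR[OF pw_one_C], of "- c"] pw_D_scaleR[OF pw_one_C, of "- c"] pw_D_one
    by simp
qed

lemma sum_pw_D_C:
  assumes "\<And>a. a \<in> A \<Longrightarrow> F a \<in> pw_C x k (Suc n)"
  shows "(\<Sum>a\<in>A. pw_D x k (F a)) \<in> pw_C x k n"
  using assms by (intro subspace_sum[OF subspace_pw_C] pw_D_C)

lemma pw_D_pow_apply: "i \<le> k \<Longrightarrow> (pw_D x k ^^ p) F i = (deriv_on (piece x i) ^^ p) (F i)"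
  by (induction p) (auto simp: pw_D_def)

lemma pw_D_pow_add:
  "F \<in> pw_C x k n \<Longrightarrow> G \<in> pw_C x k n \<Longrightarrow> p \<le> n \<Longrightarrow>
    (pw_D x k ^^ p) (F + G) = (pw_D x k ^^ p) F + (pw_D x k ^^ p) G"
proof (induction p arbitrary: F G n)
  case (Suc p)
  then obtain n' where n: "n = Suc n'" "p \<le> n'" by (cases n) auto
  note C = Suc.prems(1,2)[unfolded n]
  show ?case
    unfolding funpow_Suc_right comp_apply pw_D_add[OF C]
    by (rule Suc.IH[OF pw_D_C[OF C(1)] pw_D_C[OF C(2)] n(2)])
qed simp

lemma pw_D_pow_scaleR:
  "F \<in> pw_C x k n \<Longrightarrow> p \<le> n \<Longrightarrow> (pw_D x k ^^ p) (c *\<^sub>R F) = c *\<^sub>R (pw_D x k ^^ p) F"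
proof (induction p arbitrary: F n)
  case (Suc p)
  then obtain n' where n: "n = Suc n'" "p \<le> n'" by (cases n) auto
  note C = Suc.prems(1)[unfolded n]
  show ?case
    unfolding funpow_Suc_right comp_apply pw_D_scaleR[OF C]
    by (rule Suc.IH[OF pw_D_C[OF C] n(2)])
qed simp

lemma pw_D_sum:
  assumes "finite A" "\<And>a. a \<in> A \<Longrightarrow> F a \<in> pw_C x k (Suc n)"
  shows "pw_D x k (\<Sum>a\<in>A. F a) = (\<Sum>a\<in>A. pw_D x k (F a))"
  using assms
proof (induction A rule: finite_induct)
  case empty
  show ?case unfolding sum.empty using pw_D_scaleR[OF pw_C_zero, of 0] unfolding scaleR_zero_left .
next
  case (insert a A)
  have C: "F a \<in> pw_C x k (Suc n)" "(\<Sum>a\<in>A. F a) \<in> pw_C x k (Suc n)"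
    using insert.prems by (auto intro: subspace_sum[OF subspace_pw_C])
  have "pw_D x k (\<Sum>a\<in>A. F a) = (\<Sum>a\<in>A. pw_D x k (F a))"
    by (rule insert.IH) (simp add: insert.prems)
  then show ?case
    unfolding sum.insert[OF insert.hyps] pw_D_add[OF C] by (rule arg_cong)
qed

text \<open>
  A piecewise function with this property is the same as one continuous function on the whole
  interval, namely \<open>pw_val F\<close> below.
\<close>

definition knot_continuous :: "pwfun \<Rightarrow> bool" where
  "knot_continuous F \<longleftrightarrow> (\<forall>i<k. F i (x (Suc i)) = F (Suc i) (x (Suc i)))"

text \<open>
  The constants on neighbouring pieces agree because their values at the common knot do. This
  is the kernel of differentiation, and it is used wherever a function is recovered from its
  derivative.
\<close>

lemma pw_D_zero_imp_const:
  assumes "F \<in> pw_C x k (Suc n)" "pw_D x k F = 0" "knot_continuous F"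
  shows "F = F 0 (x 0) *\<^sub>R pw_one x k"
proof -
  have const: "F i = const_on {x i..x (Suc i)} (F i (x i))" if "i \<le> k" for i
    using deriv_on_zero_imp_const[OF knots_increasing[OF that] pw_C_D[OF assms(1) that]]
      pw_D_apply[OF that, of F] assms(2) by simp
  have "F i (x i) = F 0 (x 0)" if "i \<le> k" for i
    using that
  proof (induction i)
    case (Suc i)
    then have "F i (x (Suc i)) = F i (x i)"
      using const[of i] knots_increasing[of i]
      by (metis Suc_leD atLeastAtMost_iff const_on_apply less_imp_le order_refl)
    then show ?case using Suc assms(3) by (simp add: knot_continuous_def)
  qed simp
  with const have "F i t = F 0 (x 0)" if "i \<le> k" "t \<in> piece x i" for i t
    using that by (metis const_on_apply piece_def)
  then show ?thesis
    by (intro pw_eqI[OF assms(1) pw_C_scaleR[OF pw_one_C]]) (simp add: pw_one_def const_on_def)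
qed

section \<open>Rolle's theorem for piecewise functions and zero counts\<close>

text \<open>
  The glued function. At a knot it takes the value of the piece on the left, which for a
  \<^const>\<open>knot_continuous\<close> function is also that of the piece on the right.
\<close>

definition pw_val :: "pwfun \<Rightarrow> real \<Rightarrow> real" where
  "pw_val F t = F (LEAST i. t \<le> x (Suc i)) t"

lemma pw_val_eq:
  assumes "knot_continuous F" "i \<le> k" "t \<in> piece x i"
  shows "pw_val F t = F i t"
proof -
  define l where "l = (LEAST i. t \<le> x (Suc i))"
  have t: "x i \<le> t" "t \<le> x (Suc i)" using assms(3) by (auto simp: piece_def)
  have l: "l \<le> i" "t \<le> x (Suc l)"
    using t(2) unfolding l_def by (auto intro: LeastI Least_le)
  show ?thesis
  proof (cases "l = i")
    case True
    then show ?thesis by (simp add: pw_val_def l_def)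
  next
    case False
    have "\<not> Suc l < i" using knots_less[of "Suc l" i] l(2) t assms(2) by auto
    with False l have "i = Suc l" by simp
    moreover from this have "t = x (Suc l)" using t(1) l(2) by simp
    ultimately show ?thesis using assms(1,2) unfolding pw_val_def l_def[symmetric]
      by (simp add: knot_continuous_def)
  qed
qed

lemma continuous_on_pw_val:
  assumes "F \<in> pw_C x k n" "knot_continuous F"
  shows "continuous_on {x 0..x (Suc k)} (pw_val F)"
  unfolding Union_pieces
proof (rule continuous_on_closed_Union)
  fix i assume "i \<in> {..k}"
  then have "continuous_on (piece x i) (F i)"
    using pw_C_D[OF assms(1)] by (auto simp: piece_def intro: C_on_continuous)
  then show "continuous_on (piece x i) (pw_val F)"
    by (rule continuous_on_eq) (use \<open>i \<in> {..k}\<close> pw_val_eq[OF assms(2)] in auto)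
next
  show "finite {..k}" by simp
  show "closed (piece x i)" for i by (simp add: piece_def)
qed

text \<open>
  At a maximum the left derivative of \<open>F\<close> is nonnegative and the right derivative is
  nonpositive. At a knot these are different numbers, divided by different values of \<open>W\<close>;
  but the weights are positive and the quotient \<open>DF / W\<close> is continuous there, so its single
  value is both nonnegative and nonpositive.
\<close>

lemma pw_critical_point:
  assumes F: "F \<in> pw_C x k (Suc n)" "knot_continuous F"
    and W: "pw_positive x k W" and G: "knot_continuous (pw_D x k F / W)"
    and ab: "x 0 \<le> \<alpha>" "\<beta> \<le> x (Suc k)" and \<xi>: "\<alpha> < \<xi>" "\<xi> < \<beta>"
    and max: "\<And>t. \<alpha> < t \<Longrightarrow> t < \<beta> \<Longrightarrow> pw_val F t \<le> pw_val F \<xi>"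
  shows "pw_val (pw_D x k F / W) \<xi> = 0"
proof -
  have *: "(F i has_real_derivative pw_D x k F i \<xi>) (at \<xi> within {x i..x (Suc i)})"
    "W i \<xi> > 0" "pw_val (pw_D x k F / W) \<xi> = pw_D x k F i \<xi> / W i \<xi>"
    "\<And>t. t \<in> {x i..x (Suc i)} \<Longrightarrow> \<alpha> < t \<Longrightarrow> t < \<beta> \<Longrightarrow> F i t \<le> F i \<xi>"
    if i: "i \<le> k" "\<xi> \<in> piece x i" for i
  proof -
    show "(F i has_real_derivative pw_D x k F i \<xi>) (at \<xi> within {x i..x (Suc i)})"
      unfolding pw_D_apply[OF i(1)]
      by (rule C_on_has_derivative[OF knots_increasing[OF i(1)] pw_C_D[OF F(1) i(1)]
            i(2)[unfolded piece_def]])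
    show "W i \<xi> > 0" using W i by (simp add: pw_positive_def)
    show "pw_val (pw_D x k F / W) \<xi> = pw_D x k F i \<xi> / W i \<xi>"
      using pw_val_eq[OF G i] by simp
    show "F i t \<le> F i \<xi>" if "t \<in> {x i..x (Suc i)}" "\<alpha> < t" "t < \<beta>" for t
      using max[of t] pw_val_eq[OF F(2) i] pw_val_eq[OF F(2) i(1), of t] that by (simp add: piece_def)
  qed
  obtain i where i: "i \<le> k" "x i < \<xi>" "\<xi> \<le> x (Suc i)" using piece_left[of \<xi>] ab \<xi> by auto
  then have pi: "\<xi> \<in> piece x i" by (simp add: piece_def)
  have "0 \<le> pw_D x k F i \<xi>"
    by (rule has_derivative_at_max_sign(1)[OF *(1)[OF i(1) pi] \<xi> *(4)[OF i(1) pi] i(2,3)])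
  then have "0 \<le> pw_val (pw_D x k F / W) \<xi>" using *(2,3)[OF i(1) pi] by simp
  moreover obtain j where j: "j \<le> k" "x j \<le> \<xi>" "\<xi> < x (Suc j)" using piece_right[of \<xi>] ab \<xi> by auto
  then have pj: "\<xi> \<in> piece x j" by (simp add: piece_def)
  have "pw_D x k F j \<xi> \<le> 0"
    by (rule has_derivative_at_max_sign(2)[OF *(1)[OF j(1) pj] \<xi> *(4)[OF j(1) pj] j(2,3)])
  then have "pw_val (pw_D x k F / W) \<xi> \<le> 0" using *(2,3)[OF j(1) pj] by (simp add: divide_nonpos_pos)
  ultimately show ?thesis by simp
qed

lemma knot_continuous_scaleR: "knot_continuous F \<Longrightarrow> knot_continuous (c *\<^sub>R F)"
  by (simp add: knot_continuous_def)

text \<open>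
  A continuous function vanishing at both ends has an interior maximum or minimum, or is
  identically zero; in each case \<open>pw_critical_point\<close> applies, to \<open>F\<close> or to \<open>- F\<close>.
\<close>

lemma pw_rolle:
  assumes F: "F \<in> pw_C x k (Suc n)" "knot_continuous F"
    and W: "pw_positive x k W" and G: "knot_continuous (pw_D x k F / W)"
    and ab: "x 0 \<le> \<alpha>" "\<alpha> < \<beta>" "\<beta> \<le> x (Suc k)" and zero: "pw_val F \<alpha> = 0" "pw_val F \<beta> = 0"
  shows "\<exists>\<xi>. \<alpha> < \<xi> \<and> \<xi> < \<beta> \<and> pw_val (pw_D x k F / W) \<xi> = 0"
proof -
  have cont: "continuous_on {\<alpha>..\<beta>} (pw_val F)"
    by (rule continuous_on_subset[OF continuous_on_pw_val[OF F]]) (use ab in auto)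
  have ne: "{\<alpha>..\<beta>} \<noteq> {}" using ab by simp
  obtain p where p: "p \<in> {\<alpha>..\<beta>}" "\<forall>t\<in>{\<alpha>..\<beta>}. pw_val F t \<le> pw_val F p"
    using continuous_attains_sup[OF compact_Icc ne cont] by blast
  obtain q where q: "q \<in> {\<alpha>..\<beta>}" "\<forall>t\<in>{\<alpha>..\<beta>}. pw_val F q \<le> pw_val F t"
    using continuous_attains_inf[OF compact_Icc ne cont] by blast
  have crit: "pw_val (pw_D x k F / W) \<xi> = 0"
    if "\<alpha> < \<xi>" "\<xi> < \<beta>" "\<forall>t\<in>{\<alpha>..\<beta>}. pw_val F t \<le> pw_val F \<xi>" for \<xi>
    using pw_critical_point[OF F W G ab(1,3) that(1,2)] that(3) by simp
  consider (max) "\<alpha> < p" "p < \<beta>" | (min) "\<alpha> < q" "q < \<beta>"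
    | (ends) "p = \<alpha> \<or> p = \<beta>" "q = \<alpha> \<or> q = \<beta>"
    using p(1) q(1) by fastforce
  then show ?thesis
  proof cases
    case max
    then show ?thesis using crit p(2) by blast
  next
    case min
    have val: "pw_val (c *\<^sub>R H) t = c * pw_val H t" for c H t by (simp add: pw_val_def)
    have eq: "pw_D x k ((- 1) *\<^sub>R F) / W = (- 1) *\<^sub>R (pw_D x k F / W)"
      unfolding pw_D_scaleR[OF F(1)] by (simp add: fun_eq_iff)
    have "pw_val (pw_D x k ((- 1) *\<^sub>R F) / W) q = 0"
    proof (rule pw_critical_point[OF pw_C_scaleR[OF F(1)] knot_continuous_scaleR[OF F(2)] W _ ab(1,3) min])
      show "knot_continuous (pw_D x k ((- 1) *\<^sub>R F) / W)"
        unfolding eq by (rule knot_continuous_scaleR[OF G])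
      show "pw_val ((- 1) *\<^sub>R F) t \<le> pw_val ((- 1) *\<^sub>R F) q" if "\<alpha> < t" "t < \<beta>" for t
        unfolding val using q(2) that by simp
    qed
    then have "pw_val (pw_D x k F / W) q = 0" unfolding eq val by simp
    then show ?thesis using min by blast
  next
    case ends
    then have "pw_val F p = 0" "pw_val F q = 0" using zero by auto
    then have "\<forall>t\<in>{\<alpha>..\<beta>}. pw_val F t = 0" using p(2) q(2) by (simp add: order_antisym)
    then have "pw_val (pw_D x k F / W) ((\<alpha> + \<beta>) / 2) = 0" using ab by (intro crit) auto
    then show ?thesis using ab by (intro exI[of _ "(\<alpha> + \<beta>) / 2"]) auto
  qed
qed

lemma pw_zero_mult_props:
  assumes "t \<in> {x 0..x (Suc k)}"
  shows pw_zero_mult_attained: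
      "\<exists>i\<le>k. t \<in> piece x i \<and> pw_zero_mult x k n F t = zero_mult n (piece x i) (F i) t"
    and pw_zero_mult_ge:
      "i \<le> k \<Longrightarrow> t \<in> piece x i \<Longrightarrow> zero_mult n (piece x i) (F i) t \<le> pw_zero_mult x k n F t"
proof -
  let ?M = "{zero_mult n (piece x i) (F i) t |i. i \<le> k \<and> t \<in> piece x i}"
  have fin: "finite ?M" by simp
  obtain i0 where "i0 \<le> k" "t \<in> piece x i0" using assms by (rule piece_cover)
  then have "?M \<noteq> {}" by blast
  then have "pw_zero_mult x k n F t \<in> ?M" unfolding pw_zero_mult_def by (rule Max_in[OF fin])
  then show "\<exists>i\<le>k. t \<in> piece x i \<and> pw_zero_mult x k n F t = zero_mult n (piece x i) (F i) t"
    by blast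
  show "zero_mult n (piece x i) (F i) t \<le> pw_zero_mult x k n F t" if "i \<le> k" "t \<in> piece x i"
    unfolding pw_zero_mult_def using that by (intro Max_ge[OF fin]) blast
qed

lemma pw_zero_mult_pos_iff:
  assumes "knot_continuous F" "t \<in> {x 0..x (Suc k)}" 
  shows "0 < pw_zero_mult x k (Suc n) F t \<longleftrightarrow> pw_val F t = 0"
proof
  assume "0 < pw_zero_mult x k (Suc n) F t"
  with pw_zero_mult_attained[OF assms(2), of "Suc n" F] obtain i
    where i: "i \<le> k" "t \<in> piece x i" "0 < zero_mult (Suc n) (piece x i) (F i) t" by auto
  from vanishes_mono[OF vanishes_zero_mult, of 1] i(3) have "F i t = 0"
    using vanishes_Suc[of 0] by (metis One_nat_def Suc_leI)
  then show "pw_val F t = 0" using pw_val_eq[OF assms(1) i(1,2)] by simp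
next
  assume 0: "pw_val F t = 0"
  obtain i where i: "i \<le> k" "t \<in> piece x i" using piece_cover[OF assms(2)] .
  have "vanishes 1 (piece x i) (F i) t" using 0 pw_val_eq[OF assms(1) i] vanishes_Suc[of 0] by simp
  then have "1 \<le> zero_mult (Suc n) (piece x i) (F i) t" by (intro zero_mult_ge) auto
  then show "0 < pw_zero_mult x k (Suc n) F t" using pw_zero_mult_ge[OF assms(2) i, of "Suc n" F] by simp
qed

lemma pw_zero_mult_divide_le:
  assumes "F \<in> pw_C x k n" "W \<in> pw_C x k n" "pw_positive x k W" "t \<in> {x 0..x (Suc k)}"
  shows "pw_zero_mult x k (Suc n) F t \<le> pw_zero_mult x k (Suc n) (F / W) t"
proof -
  obtain i where i: "i \<le> k" "t \<in> piece x i"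
    "pw_zero_mult x k (Suc n) F t = zero_mult (Suc n) (piece x i) (F i) t"
    using pw_zero_mult_attained[OF assms(4)] by blast
  let ?r = "zero_mult (Suc n) (piece x i) (F i) t"
  have "vanishes ?r (piece x i) (F i / W i) t"
    using vanishes_divide_iff[OF knots_increasing[OF i(1)] _ pw_C_D[OF assms(1) i(1)]
        pw_C_D[OF assms(2) i(1)] zero_mult_le] assms(3) i(1) vanishes_zero_mult
    unfolding piece_def pw_positive_def by (metis less_irrefl)
  then have "?r \<le> zero_mult (Suc n) (piece x i) ((F / W) i) t"
    by (intro zero_mult_ge zero_mult_le) simp
  also have "\<dots> \<le> pw_zero_mult x k (Suc n) (F / W) t" by (rule pw_zero_mult_ge[OF assms(4) i(1,2)])
  finally show ?thesis using i(3) by simp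
qed

lemma pw_zero_mult_D_ge:
  assumes "t \<in> {x 0..x (Suc k)}"
  shows "pw_zero_mult x k (Suc n) F t \<le> Suc (pw_zero_mult x k n (pw_D x k F) t)"
proof -
  obtain i where i: "i \<le> k" "t \<in> piece x i"
    "pw_zero_mult x k (Suc n) F t = zero_mult (Suc n) (piece x i) (F i) t"
    using pw_zero_mult_attained[OF assms] by blast
  let ?r = "zero_mult (Suc n) (piece x i) (F i) t"
  have "?r - 1 \<le> zero_mult n (piece x i) (pw_D x k F i) t"
  proof (cases ?r)
    case (Suc r)
    have "vanishes r (piece x i) (deriv_on (piece x i) (F i)) t"
      using vanishes_zero_mult[of "Suc n" "piece x i" "F i" t] unfolding Suc by (simp add: vanishes_Suc)
    then show ?thesis using Suc zero_mult_le[of "Suc n" "piece x i" "F i" t] i(1)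
      by (auto simp: pw_D_def intro: zero_mult_ge)
  qed simp
  also have "\<dots> \<le> pw_zero_mult x k n (pw_D x k F) t" by (rule pw_zero_mult_ge[OF assms i(1,2)])
  finally show ?thesis using i(3) by simp
qed

text \<open>
  Let \<open>F\<close> have the distinct zeros \<open>Z\<close> with multiplicities \<open>\<mu>\<close>. Then \<open>DF / W\<close> has a zero of
  multiplicity at least \<open>\<mu> - 1\<close> at each of them, and by Rolle one more zero in each of the
  \<open>card Z - 1\<close> gaps. Hence it loses at most one of the zeros of \<open>F\<close>.
\<close>

lemma zero_count_step:
  assumes F: "F \<in> pw_C x k (Suc n)" "knot_continuous F"
    and W: "W \<in> pw_C x k n" "pw_positive x k W" and G: "knot_continuous (pw_D x k F / W)"
    and bound: "\<And>B. finite B \<Longrightarrow> B \<subseteq> {x 0..x (Suc k)} \<Longrightarrow>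
      (\<Sum>t\<in>B. pw_zero_mult x k (Suc n) (pw_D x k F / W) t) \<le> n"
    and A: "finite A" "A \<subseteq> {x 0..x (Suc k)}"
  shows "(\<Sum>t\<in>A. pw_zero_mult x k (Suc (Suc n)) F t) \<le> Suc n"
proof -
  let ?\<mu> = "pw_zero_mult x k (Suc (Suc n)) F" and ?\<nu> = "pw_zero_mult x k (Suc n) (pw_D x k F / W)"
  define Z where "Z = {t \<in> A. 0 < ?\<mu> t}"
  have Z: "finite Z" "Z \<subseteq> {x 0..x (Suc k)}" using A by (auto simp: Z_def)
  have sum_Z: "(\<Sum>t\<in>A. ?\<mu> t) = (\<Sum>t\<in>Z. ?\<mu> t)"
    unfolding Z_def using A(1) by (intro sum.mono_neutral_right) auto
  show ?thesis
  proof (cases "Z = {}")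
    case True
    then show ?thesis using sum_Z by simp
  next
    case False
    have zero: "pw_val F t = 0" if "t \<in> Z" for t
      using pw_zero_mult_pos_iff[OF F(2), of t "Suc n"] that Z(2) by (auto simp: Z_def)
    have "\<exists>\<xi>. \<alpha> < \<xi> \<and> \<xi> < \<beta> \<and> pw_val (pw_D x k F / W) \<xi> = 0" if "\<alpha> \<in> Z" "\<beta> \<in> Z" "\<alpha> < \<beta>" for \<alpha> \<beta>
    proof -
      have "x 0 \<le> \<alpha>" "\<beta> \<le> x (Suc k)" using that(1,2) Z(2) by auto
      with that show ?thesis using pw_rolle[OF F W(2) G _ that(3)] zero by blast
    qed
    from interlacing_points[OF Z(1) False this]
    obtain C where C: "finite C" "Suc (card C) = card Z" "C \<inter> Z = {}"
      "\<forall>c\<in>C. pw_val (pw_D x k F / W) c = 0 \<and> Min Z < c \<and> c < Max Z" by blast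
    have "Min Z \<in> Z" "Max Z \<in> Z" using Z(1) False by auto
    then have C_sub: "C \<subseteq> {x 0..x (Suc k)}" using C(4) Z(2) by (force simp: subset_iff)
    \<comment> \<open>Old zeros lose one order each; the gaps in \<open>C\<close> supply all but one of the lost orders.\<close>
    have "(\<Sum>t\<in>Z. ?\<mu> t) \<le> (\<Sum>t\<in>Z. Suc (?\<nu> t))"
    proof (rule sum_mono)
      fix t assume "t \<in> Z"
      then have t: "t \<in> {x 0..x (Suc k)}" using Z(2) by auto
      from pw_zero_mult_D_ge[OF t, of "Suc n" F] pw_zero_mult_divide_le[OF pw_D_C[OF F(1)] W t]
      show "?\<mu> t \<le> Suc (?\<nu> t)" by simp
    qed
    also have "\<dots> = Suc ((\<Sum>t\<in>Z. ?\<nu> t) + (\<Sum>t\<in>C. 1))"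
      using C(2) by (simp add: sum.distrib sum_Suc)
    also have "\<dots> \<le> Suc ((\<Sum>t\<in>Z. ?\<nu> t) + (\<Sum>t\<in>C. ?\<nu> t))"
    proof -
      have "1 \<le> ?\<nu> c" if "c \<in> C" for c
        using pw_zero_mult_pos_iff[OF G, of c n] C(4) C_sub that by (auto simp: Suc_le_eq)
      then show ?thesis by (intro Suc_le_mono[THEN iffD2] add_left_mono sum_mono)
    qed
    also have "\<dots> = Suc (\<Sum>t\<in>Z \<union> C. ?\<nu> t)"
      using Z(1) C by (subst sum.union_disjoint) auto
    also have "\<dots> \<le> Suc n" using Z C C_sub by (intro Suc_le_mono[THEN iffD2] bound) auto
    finally show ?thesis using sum_Z by simp
  qed
qed

section \<open>Orders of vanishing across knots\<close>

text \<open>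
  This is all that is kept of the connection matrices. For triangular matrices with positive
  diagonal it holds because a triangular system transports leading zeros in both directions,
  and, unlike the matrices, it survives \<open>F \<mapsto> DF / W\<close> without any computation.
\<close>

definition knot_matched :: "nat \<Rightarrow> pwfun \<Rightarrow> bool" where
  "knot_matched n F \<longleftrightarrow> (\<forall>i<k. \<forall>r\<le>n.
     vanishes r (piece x i) (F i) (x (Suc i)) \<longleftrightarrow>
     vanishes r (piece x (Suc i)) (F (Suc i)) (x (Suc i)))"

lemma knot_in_pieces:
  assumes "i < k"
  shows "x (Suc i) \<in> piece x i" "x (Suc i) \<in> piece x (Suc i)"
  using knots_increasing[of i] knots_increasing[of "Suc i"] assms by (auto simp: piece_def)

text \<open>
  Subtracting the left value at a knot produces a left zero, hence a right zero, so the right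
  value is the same. Constants in the space therefore turn matching of zeros into continuity.
\<close>

lemma knot_matched_imp_continuous:
  assumes "\<And>c. knot_matched (Suc n) (F - c *\<^sub>R pw_one x k)"
  shows "knot_continuous F"
  unfolding knot_continuous_def
proof (intro allI impI)
  fix i assume i: "i < k"
  \<comment> \<open>A left zero of order one; matching up to order one makes it a right zero.\<close>
  let ?H = "F - F i (x (Suc i)) *\<^sub>R pw_one x k"
  have "vanishes 1 (piece x i) (?H i) (x (Suc i))"
    using knot_in_pieces[OF i] i by (simp add: vanishes_def pw_one_def const_on_def)
  then have "vanishes 1 (piece x (Suc i)) (?H (Suc i)) (x (Suc i))"
    using assms[unfolded knot_matched_def, rule_format, OF i, of 1] by simp
  then show "F i (x (Suc i)) = F (Suc i) (x (Suc i))"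
    using knot_in_pieces[OF i] i by (simp add: vanishes_def pw_one_def const_on_def)
qed

text \<open>
  For \<open>c = F(x\<^sub>i)\<close> the function \<open>F - c\<close> vanishes at \<open>x\<^sub>i\<close> from both sides, so a zero of order
  \<open>r\<close> of \<open>DF\<close> is the same as a zero of order \<open>r + 1\<close> of \<open>F - c\<close>, on either side. Division by
  \<open>W\<close> does not change the order.
\<close>

lemma knot_matched_D_divide:
  assumes F: "F \<in> pw_C x k (Suc n)" and W: "W \<in> pw_C x k n" "pw_positive x k W"
    and matched: "\<And>c. knot_matched (Suc (Suc n)) (F - c *\<^sub>R pw_one x k)"
  shows "knot_matched (Suc n) (pw_D x k F / W)"
  unfolding knot_matched_def
proof (intro allI impI)
  fix i r assume i: "i < k" and r: "r \<le> Suc n"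
  let ?t = "x (Suc i)"
  let ?H = "F - F i ?t *\<^sub>R pw_one x k"
  have "F i ?t = F (Suc i) ?t"
    using knot_matched_imp_continuous[OF matched] i by (simp add: knot_continuous_def)
  then have zero: "?H i ?t = 0" "?H (Suc i) ?t = 0"
    using knot_in_pieces[OF i] i by (simp_all add: pw_one_def const_on_def)
  have iff: "vanishes r (piece x j) ((pw_D x k F / W) j) ?t \<longleftrightarrow> vanishes (Suc r) (piece x j) (?H j) ?t"
    if j: "j \<le> k" and "?H j ?t = 0" for j
  proof -
    have "\<forall>t\<in>{x j..x (Suc j)}. W j t \<noteq> 0"
      using W(2) j unfolding pw_positive_def piece_def by (metis less_irrefl)
    then have "vanishes r (piece x j) ((pw_D x k F / W) j) ?t \<longleftrightarrow>
        vanishes r (piece x j) (pw_D x k F j) ?t"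
      unfolding piece_def divide_fun_apply[of "pw_D x k F"]
      by (rule vanishes_divide_iff[OF knots_increasing[OF j] _ pw_C_D[OF pw_D_C[OF F] j]
            pw_C_D[OF W(1) j] r])
    also have "pw_D x k F j = deriv_on (piece x j) (?H j)"
      using pw_D_diff_const[OF F, of "F i ?t"] j by (metis pw_D_def)
    also have "vanishes r (piece x j) \<dots> ?t \<longleftrightarrow> vanishes (Suc r) (piece x j) (?H j) ?t"
      using that(2) unfolding vanishes_Suc by blast
    finally show ?thesis .
  qed
  have "vanishes (Suc r) (piece x i) (?H i) ?t \<longleftrightarrow> vanishes (Suc r) (piece x (Suc i)) (?H (Suc i)) ?t"
    using matched[of "F i ?t"] i r unfolding knot_matched_def by simp
  then show "vanishes r (piece x i) ((pw_D x k F / W) i) ?t \<longleftrightarrow>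
      vanishes r (piece x (Suc i)) ((pw_D x k F / W) (Suc i)) ?t"
    using iff[of i] iff[of "Suc i"] zero i by simp
qed

lemma pw_divide_self: "pw_positive x k W \<Longrightarrow> W \<in> pw_C x k n \<Longrightarrow> W / W = pw_one x k"
  by (rule pw_eqI[OF pw_C_divide pw_one_C])
     (force simp: pw_positive_def pw_one_def const_on_def)+

lemma pw_divide_one: "F \<in> pw_C x k n \<Longrightarrow> F / pw_one x k = F"
  using pw_C_outside[of F n] by (fastforce simp: fun_eq_iff pw_one_def const_on_def)

lemma pw_divide_cancel:
  assumes "F \<in> pw_C x k n" "G \<in> pw_C x k p" "pw_positive x k W" "F / W = G / W"
  shows "F = G"
proof (rule pw_eqI[OF assms(1,2)])
  fix i t assume "i \<le> k" "t \<in> piece x i"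
  then have "W i t \<noteq> 0" using assms(3) by (force simp: pw_positive_def)
  moreover have "F i t / W i t = G i t / W i t" using assms(4) by (metis divide_fun_apply)
  ultimately show "F i t = G i t" by simp
qed

end

section \<open>Chains of spaces linked by weighted differentiation\<close>

text \<open>
  The abstract situation reached by the recursion: each space contains the constants, is
  continuous at the knots, and is mapped by \<open>F \<mapsto> DF / w\<close> onto the next one, down to the
  constants alone. One order of smoothness is spent at each step. These facts bound the zeros in
  each space and describe it by generalized derivatives (\<open>is_ECP_level\<close>).
\<close>

locale weight_chain = partition +
  fixes N :: nat and E :: "nat \<Rightarrow> pwfun set" and w :: "nat \<Rightarrow> pwfun"
  assumes subspace_E: "j \<le> N \<Longrightarrow> subspace (E j)"
    and one_E: "j \<le> N \<Longrightarrow> pw_one x k \<in> E j"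
    and smooth_E: "j \<le> N \<Longrightarrow> E j \<subseteq> pw_C x k (N - j)"
    and continuous_E: "j \<le> N \<Longrightarrow> F \<in> E j \<Longrightarrow> knot_continuous F"
    and w_positive: "j < N \<Longrightarrow> pw_positive x k (w (Suc j))"
    and w_smooth: "j < N \<Longrightarrow> w (Suc j) \<in> pw_C x k (N - Suc j)"
    and E_Suc: "j < N \<Longrightarrow> E (Suc j) = (\<lambda>F. pw_D x k F / w (Suc j)) ` E j"
    and E_last: "F \<in> E N \<Longrightarrow> \<exists>c. F = c *\<^sub>R pw_one x k"
begin

lemma const_zero_count:
  assumes "c *\<^sub>R pw_one x k \<noteq> 0" "A \<subseteq> {x 0..x (Suc k)}"
  shows "(\<Sum>t\<in>A. pw_zero_mult x k (Suc n) (c *\<^sub>R pw_one x k) t) = 0"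
proof (rule sum.neutral, rule ballI)
  fix t assume "t \<in> A"
  then have t: "t \<in> {x 0..x (Suc k)}" using assms(2) by blast
  obtain i where i: "i \<le> k" "t \<in> piece x i" using t by (rule piece_cover)
  have cont: "knot_continuous (c *\<^sub>R pw_one x k)"
    by (intro knot_continuous_scaleR continuous_E[of 0] one_E) auto
  have "pw_val (c *\<^sub>R pw_one x k) t \<noteq> 0"
    using assms(1) i unfolding pw_val_eq[OF cont i] by (auto simp: pw_one_def const_on_def)
  then show "pw_zero_mult x k (Suc n) (c *\<^sub>R pw_one x k) t = 0"
    using pw_zero_mult_pos_iff[OF cont t, of n] by blast
qed

text \<open>
  Nonzero constants have no zeros, and each step up the chain adds at most one zero
  (\<open>zero_count_step\<close>). If the next function \<open>DF / w\<close> is zero, then \<open>F\<close> is itself a constant.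
\<close>

lemma zero_count:
  assumes "j \<le> N" "F \<in> E j" "F \<noteq> 0" "finite A" "A \<subseteq> {x 0..x (Suc k)}"
  shows "(\<Sum>t\<in>A. pw_zero_mult x k (Suc (N - j)) F t) \<le> N - j"
  using assms
proof (induction j arbitrary: F A rule: inc_induct)
  case base
  then obtain c where c: "F = c *\<^sub>R pw_one x k" using E_last by blast
  show ?case using const_zero_count[of c A "N - N"] base unfolding c by (metis le0)
next
  case (step j)
  define p where "p = N - Suc j"
  have p: "N - j = Suc p" using step.hyps by (simp add: p_def)
  let ?G = "pw_D x k F / w (Suc j)"
  have F: "F \<in> pw_C x k (Suc p)" "knot_continuous F"
    using smooth_E[of j] continuous_E[of j] step p by auto
  have W: "w (Suc j) \<in> pw_C x k p" "pw_positive x k (w (Suc j))"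
    using w_smooth w_positive step.hyps by (auto simp: p_def)
  have G: "?G \<in> E (Suc j)" using E_Suc[of j] step by auto
  show ?case
  proof (cases "?G = 0")
    case True
    then have "?G = 0 / w (Suc j)" by (simp add: fun_eq_iff)
    then have "pw_D x k F = 0" by (rule pw_divide_cancel[OF pw_D_C[OF F(1)] pw_C_zero W(2)])
    then have "F = F 0 (x 0) *\<^sub>R pw_one x k" by (rule pw_D_zero_imp_const[OF F(1) _ F(2)])
    then show ?thesis
      using const_zero_count[of "F 0 (x 0)" A "N - j"] step.prems by simp
  next
    case False
    have "(\<Sum>t\<in>A. pw_zero_mult x k (Suc (Suc p)) F t) \<le> Suc p"
    proof (rule zero_count_step[OF F W continuous_E[OF _ G] _ step.prems(3,4)])
      show "(\<Sum>t\<in>B. pw_zero_mult x k (Suc p) ?G t) \<le> p"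
        if "finite B" "B \<subseteq> {x 0..x (Suc k)}" for B
        using step.IH[OF G False that] unfolding p_def .
    qed (use step.hyps in simp)
    then show ?thesis by (simp add: p)
  qed
qed

text \<open>
  The next space is the full image of \<open>E j\<close>, so some \<open>F\<close> in \<open>E j\<close> has the same derivative as
  \<open>H\<close>; the two differ by a constant, and constants lie in \<open>E j\<close>.
\<close>

lemma antiderivative_in_E:
  assumes "j < N" "H \<in> pw_C x k (Suc n)" "knot_continuous H" "pw_D x k H / w (Suc j) \<in> E (Suc j)"
  shows "H \<in> E j"
proof -
  obtain F where F: "F \<in> E j" "pw_D x k H / w (Suc j) = pw_D x k F / w (Suc j)"
    using assms(1,4) E_Suc by auto
  obtain p where p: "N - j = Suc p" using assms(1) by (cases "N - j") auto
  \<comment> \<open>The smoothness of \<open>H\<close> may differ from that of \<open>E j\<close>; \<open>q + 1\<close> derivatives exist for both.\<close>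
  define q where "q = min n p"
  have H: "H \<in> pw_C x k (Suc q)" using assms(2) by (rule pw_C_mono) (simp add: q_def)
  have "F \<in> pw_C x k (N - j)" using smooth_E[of j] F(1) assms(1) by auto
  then have FC: "F \<in> pw_C x k (Suc q)" by (rule pw_C_mono) (simp add: q_def p)
  have eq: "pw_D x k H = pw_D x k F"
    by (rule pw_divide_cancel[OF pw_D_C[OF H] pw_D_C[OF FC] w_positive[OF assms(1)] F(2)])
  define K where "K = H + (- 1) *\<^sub>R F"
  have K: "K \<in> pw_C x k (Suc q)" unfolding K_def by (intro pw_C_add pw_C_scaleR H FC)
  have "pw_D x k K = 0"
    unfolding K_def pw_D_add[OF H pw_C_scaleR[OF FC]] pw_D_scaleR[OF FC] eq by simp
  moreover have "knot_continuous K"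
    using assms(3) continuous_E[OF _ F(1)] assms(1) by (simp add: K_def knot_continuous_def)
  ultimately have "\<exists>c. K = c *\<^sub>R pw_one x k" by (intro exI) (rule pw_D_zero_imp_const[OF K])
  then obtain c where c: "K = c *\<^sub>R pw_one x k" ..
  have "K \<in> E j"
    unfolding c using assms(1) by (intro subspace_scale[OF subspace_E] one_E) simp_all
  then have "K + F \<in> E j" using subspace_add[OF subspace_E] F(1) assms(1) by simp
  then show ?thesis by (simp add: K_def)
qed

text \<open>
  The zero bound is \<open>zero_count\<close>. For the description of \<open>V\<close> by generalized derivatives, one
  inclusion says that generalized derivatives run down the chain, where everything is
  continuous and the last space is constant. The other climbs back up from the constants with
  \<open>antiderivative_in_E\<close>. The initial weight \<open>v 0\<close> is left free: \<open>v 0 = 1\<close>, \<open>j = 0\<close> gives \<open>S\<close>,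
  and \<open>v 0 = w 1\<close>, \<open>j = 1\<close> gives \<open>DS = w 1 \<cdot> E 1\<close>.
\<close>

theorem is_ECP_level:
  assumes j: "j \<le> N" and v0: "pw_positive x k (v 0)" "v 0 \<in> pw_C x k (N - j)"
    and v_Suc: "\<And>i. i < N - j \<Longrightarrow> v (Suc i) = w (Suc (j + i))"
    and V: "V = {F \<in> pw_C x k (N - j). F / v 0 \<in> E j}" and dim: "dim V = Suc (N - j)"
  shows "is_ECP x k (Suc (N - j)) v V"
proof -
  have v_pos: "pw_positive x k (v i)" and v_smooth: "v i \<in> pw_C x k (N - j - i)" if "i \<le> N - j" for i
  proof -
    show "pw_positive x k (v i)"
    proof (cases i)
      case (Suc p)
      then show ?thesis using that w_positive[of "j + p"] v_Suc[of p] by simp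
    qed (use v0 in simp)
    show "v i \<in> pw_C x k (N - j - i)"
    proof (cases i)
      case (Suc p)
      then have "w (Suc (j + p)) \<in> pw_C x k (N - Suc (j + p))" using that by (intro w_smooth) simp
      moreover have "N - Suc (j + p) = N - j - i" using Suc by simp
      moreover have "v i = w (Suc (j + p))" using v_Suc[of p] Suc that by simp
      ultimately show ?thesis by (simp only:)
    qed (use v0 in simp)
  qed
  have weights: "weight_system x k (Suc (N - j)) v"
    using v_pos v_smooth unfolding weight_system_def by auto
  have gen_deriv_E: "gen_deriv x k v i F \<in> E (j + i)" if "F \<in> V" "i \<le> N - j" for F i
    using that(2)
  proof (induction i)
    case 0
    have "F / v 0 \<in> E j" using that(1) V by blast
    then show ?case unfolding gen_deriv.simps(1) add_0_right .
  next
    case (Suc i)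
    then have "pw_D x k (gen_deriv x k v i F) / w (Suc (j + i)) \<in> E (Suc (j + i))"
      using E_Suc[of "j + i"] by auto
    moreover have "v (Suc i) = w (Suc (j + i))" using Suc.prems by (intro v_Suc) simp
    ultimately show ?case unfolding gen_deriv.simps(2) add_Suc_right by (simp only:)
  qed
  have sub: "subspace V"
    unfolding V subspace_def
  proof (intro conjI ballI allI)
    have "0 / v 0 = 0" by (simp add: fun_eq_iff)
    then show "0 \<in> {F \<in> pw_C x k (N - j). F / v 0 \<in> E j}"
      using pw_C_zero subspace_0[OF subspace_E[OF j]] by simp
  next
    fix F G assume FG: "F \<in> {F \<in> pw_C x k (N - j). F / v 0 \<in> E j}" "G \<in> {F \<in> pw_C x k (N - j). F / v 0 \<in> E j}"
    have "(F + G) / v 0 = F / v 0 + G / v 0" by (simp add: fun_eq_iff add_divide_distrib)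
    then show "F + G \<in> {F \<in> pw_C x k (N - j). F / v 0 \<in> E j}"
      using FG subspace_add[OF subspace_E[OF j], of "F / v 0" "G / v 0"] by (simp add: pw_C_add)
  next
    fix c :: real and F assume F: "F \<in> {F \<in> pw_C x k (N - j). F / v 0 \<in> E j}"
    have "(c *\<^sub>R F) / v 0 = c *\<^sub>R (F / v 0)" by (simp add: fun_eq_iff)
    then show "c *\<^sub>R F \<in> {F \<in> pw_C x k (N - j). F / v 0 \<in> E j}"
      using F subspace_scale[OF subspace_E[OF j], of "F / v 0" c] by (simp add: pw_C_scaleR)
  qed
  have zeros: "total_mult {x 0..x (Suc k)} (pw_zero_mult x k (Suc (N - j)) F) \<le> enat (N - j)"
    if F: "F \<in> V" "F \<noteq> 0" for F
  proof (rule total_mult_le)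
    fix A assume A: "finite A" "A \<subseteq> {x 0..x (Suc k)}"
    have FC: "F \<in> pw_C x k (N - j)" using F(1) V by simp
    have "F / v 0 \<noteq> 0"
    proof
      assume "F / v 0 = 0"
      then have "F / v 0 = 0 / v 0" by (simp add: fun_eq_iff)
      then have "F = 0" by (rule pw_divide_cancel[OF FC pw_C_zero v0(1)])
      then show False using F(2) by simp
    qed
    then have "(\<Sum>t\<in>A. pw_zero_mult x k (Suc (N - j)) (F / v 0) t) \<le> N - j"
      using zero_count[OF j _ _ A] F(1) V by simp
    moreover have "(\<Sum>t\<in>A. pw_zero_mult x k (Suc (N - j)) F t) \<le>
        (\<Sum>t\<in>A. pw_zero_mult x k (Suc (N - j)) (F / v 0) t)"
      using A(2) by (intro sum_mono pw_zero_mult_divide_le[OF FC v0(2,1)]) blast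
    ultimately show "(\<Sum>t\<in>A. pw_zero_mult x k (Suc (N - j)) F t) \<le> N - j" by simp
  qed
  have ECP: "ECP_space x k (Suc (N - j)) V"
    unfolding ECP_space_def using sub dim zeros V by auto
  let ?T = "{F \<in> pw_C x k (Suc (N - j) - 1).
       (\<exists>c. \<forall>i\<le>k. \<forall>t\<in>piece x i. gen_deriv x k v (Suc (N - j) - 1) F i t = c) \<and>
       (\<forall>i\<in>{1..k}. \<forall>p<Suc (N - j). gen_deriv x k v p F i (x i) = gen_deriv x k v p F (i - 1) (x i))}"
  have "V \<subseteq> ?T"
  proof
    fix F assume F: "F \<in> V"
    obtain c where c: "gen_deriv x k v (N - j) F = c *\<^sub>R pw_one x k"
      using gen_deriv_E[OF F, of "N - j"] E_last j by auto
    have "gen_deriv x k v p F i (x i) = gen_deriv x k v p F (i - 1) (x i)"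
      if i: "i \<in> {1..k}" and p: "p < Suc (N - j)" for i p
    proof -
      have "knot_continuous (gen_deriv x k v p F)"
        using continuous_E[OF _ gen_deriv_E[OF F, of p]] p j by simp
      moreover obtain l where "i = Suc l" "l < k" using i by (cases i) auto
      ultimately show ?thesis by (simp add: knot_continuous_def)
    qed
    moreover have "\<forall>i\<le>k. \<forall>t\<in>piece x i. gen_deriv x k v (N - j) F i t = c"
      unfolding c by (simp add: pw_one_def const_on_def)
    ultimately show "F \<in> ?T" using F V by auto
  qed
  moreover have "?T \<subseteq> V"
  proof
    fix F assume F: "F \<in> ?T"
    have smooth: "gen_deriv x k v i F \<in> pw_C x k (N - j - i)" if "i \<le> N - j" for i
      using that
    proof (induction i)
      case 0
      have "F \<in> pw_C x k (N - j)" using F by simp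
      then show ?case unfolding gen_deriv.simps(1) diff_zero by (rule pw_C_divide[OF _ v0(2,1)])
    next
      case (Suc i)
      then have "N - j - i = Suc (N - j - Suc i)" by simp
      with Suc have "gen_deriv x k v i F \<in> pw_C x k (Suc (N - j - Suc i))" by simp
      then have "pw_D x k (gen_deriv x k v i F) \<in> pw_C x k (N - j - Suc i)" by (rule pw_D_C)
      then show ?case
        unfolding gen_deriv.simps(2) by (rule pw_C_divide[OF _ v_smooth[OF Suc.prems] v_pos[OF Suc.prems]])
    qed
    have cont: "knot_continuous (gen_deriv x k v i F)" if "i \<le> N - j" for i
      unfolding knot_continuous_def
    proof (intro allI impI)
      fix l assume "l < k"
      then have "Suc l \<in> {1..k}" by simp
      with F that have "gen_deriv x k v i F (Suc l) (x (Suc l)) = gen_deriv x k v i F (Suc l - 1) (x (Suc l))"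
        by (simp only: mem_Collect_eq less_Suc_eq_le)
      then show "gen_deriv x k v i F l (x (Suc l)) = gen_deriv x k v i F (Suc l) (x (Suc l))" by simp
    qed
    have "gen_deriv x k v i F \<in> E (j + i)" if "i \<le> N - j" for i
      using that
    proof (induction i rule: inc_induct)
      case base
      obtain c where c: "\<forall>i\<le>k. \<forall>t\<in>piece x i. gen_deriv x k v (N - j) F i t = c"
        using F by auto
      have "gen_deriv x k v (N - j) F = c *\<^sub>R pw_one x k"
        by (rule pw_eqI[OF smooth[OF order_refl] pw_C_scaleR[OF pw_one_C]])
          (use c in \<open>simp add: pw_one_def const_on_def\<close>)
      moreover have "c *\<^sub>R pw_one x k \<in> E N"
        by (intro subspace_scale[OF subspace_E] one_E) simp_all
      ultimately show ?case using j by (metis le_add_diff_inverse)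
    next
      case (step i)
      then have "N - j - i = Suc (N - j - Suc i)" by simp
      then have C: "gen_deriv x k v i F \<in> pw_C x k (Suc (N - j - Suc i))"
        using smooth[of i] step.hyps by simp
      show ?case
      proof (rule antiderivative_in_E[OF _ C cont])
        show "pw_D x k (gen_deriv x k v i F) / w (Suc (j + i)) \<in> E (Suc (j + i))"
          using step.IH unfolding gen_deriv.simps(2) v_Suc[OF step.hyps(2)] add_Suc_right .
      qed (use step.hyps in auto)
    qed
    from this[of 0] show "F \<in> V" using F V by simp
  qed
  ultimately have "V = ?T" by (rule subset_antisym)
  with weights ECP show ?thesis unfolding is_ECP_def by blast
qed

end

section \<open>Spline spaces\<close>

text \<open>
  A dimension count inside an infinite-dimensional function space: an element outside the span
  of \<open>B\<close> would give \<open>n + 1\<close> independent elements, and an injective linear map would carry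
  them into the \<open>n\<close>-dimensional space \<open>U\<close>.
\<close>

lemma subspace_spanned_via_injection:
  fixes ev :: "'a::real_vector \<Rightarrow> 'b::real_vector"
  assumes ev: "linear ev" "\<And>v. v \<in> V \<Longrightarrow> ev v = 0 \<Longrightarrow> v = 0" "ev ` V \<subseteq> U"
    and V: "subspace V" and dim: "dim U = n" "n \<ge> 1"
    and B: "B \<subseteq> V" "independent B" "card B = n"
  shows "V \<subseteq> span B"
proof
  fix v assume v: "v \<in> V"
  show "v \<in> span B"
  proof (rule ccontr)
    assume nv: "v \<notin> span B"
    obtain C where C: "C \<subseteq> U" "independent C" "U \<subseteq> span C" "card C = dim U"
      using basis_exists by blast
    have fin: "finite C" using C(4) dim by (metis card.infinite not_one_le_zero)
    have finB: "finite B" using B(3) dim(2) by (metis card.infinite not_one_le_zero)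
    have "v \<notin> B" using nv span_base by blast
    have ind: "independent (insert v B)" using nv B(2) by (rule independent_insertI)
    have sub: "span (insert v B) \<subseteq> V" using v B(1) V by (intro span_minimal) auto
    have inj: "inj_on ev (span (insert v B))"
      using ev(2) sub by (subst linear_inj_on_iff_eq_0[OF ev(1) subspace_span]) blast
    have "ev ` insert v B \<subseteq> span C" using ev(3) C(3) B(1) v by blast
    with fin linear_independent_injective_image[OF ev(1) ind inj]
    have "card (ev ` insert v B) \<le> card C" by (metis independent_span_bound)
    moreover have "card (ev ` insert v B) = card (insert v B)"
      using inj span_superset by (intro card_image) (rule inj_on_subset)
    moreover have "card (insert v B) = Suc n" using finB \<open>v \<notin> B\<close> B(3) by simp
    ultimately show False using C(4) dim(1) by simp
  qed
qed

lemma EC_space_vanishes_imp_zero: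
  assumes "EC_space n J U" "f \<in> U" "t \<in> J" "vanishes n J f t"
  shows "f = 0"
proof (rule ccontr)
  assume "f \<noteq> 0"
  then have le: "total_mult J (zero_mult n J f) \<le> enat (n - 1)" and n: "n \<ge> 1"
    using assms(1,2) unfolding EC_space_def by auto
  let ?Z = "{t \<in> J. zero_mult n J f t \<noteq> 0}"
  have fin: "finite ?Z" using le by (auto simp: total_mult_def split: if_splits)
  have "n \<le> zero_mult n J f t" using assms(4) by (intro zero_mult_ge) auto
  also have "\<dots> \<le> (\<Sum>t\<in>?Z. zero_mult n J f t)"
    using fin assms(3) n \<open>n \<le> zero_mult n J f t\<close> by (intro member_le_sum) auto
  finally show False using le fin n by (simp add: total_mult_def)
qed

context partition
begin

lemma spline_space_subspace:
  assumes "\<And>i. i \<le> k \<Longrightarrow> subspace (U i)"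
  shows "subspace (spline_space (Suc n) x k U R)"
  unfolding subspace_def
proof (intro conjI ballI allI)
  let ?S = "spline_space (Suc n) x k U R"
  have zero: "(pw_D x k ^^ p) 0 = 0" if "p \<le> n" for p
    using pw_D_pow_scaleR[OF pw_C_zero that, of 0] unfolding scaleR_zero_left .
  show "0 \<in> ?S"
    using zero pw_C_zero subspace_0[OF assms] by (auto simp: spline_space_def less_Suc_eq_le)
  show "F + G \<in> ?S" if F: "F \<in> ?S" and G: "G \<in> ?S" for F G
  proof -
    have C: "F \<in> pw_C x k n" "G \<in> pw_C x k n" using F G by (auto simp: spline_space_def)
    have "(pw_D x k ^^ p) (F + G) i (x i) =
        (\<Sum>q<Suc n. R i p q * (pw_D x k ^^ q) (F + G) (i - 1) (x i))" if "i \<in> {1..k}" "p < Suc n" for i p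
    proof -
      have "(\<Sum>q<Suc n. R i p q * (pw_D x k ^^ q) (F + G) (i - 1) (x i)) =
          (\<Sum>q<Suc n. R i p q * (pw_D x k ^^ q) F (i - 1) (x i) + R i p q * (pw_D x k ^^ q) G (i - 1) (x i))"
        by (rule sum.cong) (auto simp: pw_D_pow_add[OF C] algebra_simps)
      also have "\<dots> = (pw_D x k ^^ p) F i (x i) + (pw_D x k ^^ p) G i (x i)"
        using F G that by (simp add: spline_space_def sum.distrib del: sum.lessThan_Suc)
      finally show ?thesis using pw_D_pow_add[OF C, of p] that(2) by simp
    qed
    moreover have "F i + G i \<in> U i" if "i \<le> k" for i
      using F G that by (intro subspace_add[OF assms]) (auto simp: spline_space_def)
    moreover have "F + G \<in> pw_C x k (Suc n - 1)"
      unfolding diff_Suc_1 by (rule pw_C_add[OF C])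
    ultimately show ?thesis unfolding spline_space_def mem_Collect_eq plus_fun_apply[of F G] by blast
  qed
  show "c *\<^sub>R F \<in> ?S" if F: "F \<in> ?S" for c :: real and F
  proof -
    have C: "F \<in> pw_C x k n" using F by (auto simp: spline_space_def)
    have "(pw_D x k ^^ p) (c *\<^sub>R F) i (x i) =
        (\<Sum>q<Suc n. R i p q * (pw_D x k ^^ q) (c *\<^sub>R F) (i - 1) (x i))" if "i \<in> {1..k}" "p < Suc n" for i p
    proof -
      have "(\<Sum>q<Suc n. R i p q * (pw_D x k ^^ q) (c *\<^sub>R F) (i - 1) (x i)) =
          (\<Sum>q<Suc n. c * (R i p q * (pw_D x k ^^ q) F (i - 1) (x i)))"
        by (rule sum.cong) (auto simp: pw_D_pow_scaleR[OF C])
      also have "\<dots> = c * (pw_D x k ^^ p) F i (x i)"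
        using F that by (simp add: spline_space_def sum_distrib_left[symmetric] del: sum.lessThan_Suc)
      finally show ?thesis using pw_D_pow_scaleR[OF C, of p] that(2) by simp
    qed
    moreover have "c *\<^sub>R F i \<in> U i" if "i \<le> k" for i
      using F that by (intro subspace_scale[OF assms]) (auto simp: spline_space_def)
    moreover have "c *\<^sub>R F \<in> pw_C x k (Suc n - 1)"
      unfolding diff_Suc_1 by (rule pw_C_scaleR[OF C])
    ultimately show ?thesis unfolding spline_space_def mem_Collect_eq scaleR_fun_apply[of c F] by blast
  qed
qed

text \<open>
  From left to right, each row of the connection matrix only sees derivatives of at most its
  own order. From right to left, forward substitution works because the diagonal does not
  vanish.
\<close>

lemma spline_space_matched:
  assumes R: "\<And>i. i \<in> {1..k} \<Longrightarrow> connection_matrix m (R i)" and F: "F \<in> spline_space m x k U R"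
  shows "knot_matched m F"
  unfolding knot_matched_def
proof (intro allI impI)
  fix i r assume i: "i < k" and r: "r \<le> m"
  define L where "L p = (deriv_on (piece x i) ^^ p) (F i) (x (Suc i))" for p
  define P where "P p = (deriv_on (piece x (Suc i)) ^^ p) (F (Suc i)) (x (Suc i))" for p
  have conn: "connection_matrix m (R (Suc i))" using R i by simp
  have sum: "P p = (\<Sum>q<m. R (Suc i) p q * L q)" if "p < m" for p
  proof -
    have "(pw_D x k ^^ p) F (Suc i) (x (Suc i)) =
        (\<Sum>q<m. R (Suc i) p q * (pw_D x k ^^ q) F (Suc i - 1) (x (Suc i)))"
      using F i that unfolding spline_space_def by force
    then show ?thesis
      using i unfolding P_def L_def by (simp add: pw_D_pow_apply)
  qed
  have triangular: "R (Suc i) p q = 0" if "p < q" "q < m" for p q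
    using conn that by (simp add: connection_matrix_def)
  have "(\<forall>p<r. L p = 0) \<longleftrightarrow> (\<forall>p<r. P p = 0)"
  proof
    assume L: "\<forall>p<r. L p = 0"
    show "\<forall>p<r. P p = 0"
    proof (intro allI impI)
      fix p assume p: "p < r"
      have "R (Suc i) p q * L q = 0" if "q < m" for q
        using L p that triangular[of p q] by (cases "q < r") auto
      then have "(\<Sum>q<m. R (Suc i) p q * L q) = 0" by (intro sum.neutral) auto
      then show "P p = 0" using sum[of p] p r by simp
    qed
  next
    assume P: "\<forall>p<r. P p = 0"
    show "\<forall>p<r. L p = 0"
    proof (intro allI impI)
      fix p assume "p < r"
      then show "L p = 0"
      proof (induction p rule: less_induct)
        case (less p)
        have "R (Suc i) p q * L q = 0" if "q < m" "q \<noteq> p" for q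
          using less that triangular[of p q] by (cases "q < p") auto
        then have "(\<Sum>q<m. R (Suc i) p q * L q) = (\<Sum>q\<in>{p}. R (Suc i) p q * L q)"
          using less.prems r by (intro sum.mono_neutral_right) auto
        then have "R (Suc i) p p * L p = 0" using sum[of p] P less.prems r by simp
        moreover have "R (Suc i) p p > 0" using conn less.prems r by (simp add: connection_matrix_def)
        ultimately show ?case by simp
      qed
    qed
  qed
  then show "vanishes r (piece x i) (F i) (x (Suc i)) \<longleftrightarrow>
      vanishes r (piece x (Suc i)) (F (Suc i)) (x (Suc i))"
    unfolding vanishes_def L_def P_def .
qed

text \<open>
  A zero piece has zeros of every order at its right knot, so the next piece has a zero of
  order \<open>m\<close> there, which is too much for a nonzero element of an \<open>m\<close>-dimensional EC-space.
\<close>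

lemma spline_determined_by_first_piece:
  assumes EC: "\<And>i. i \<le> k \<Longrightarrow> EC_space m (piece x i) (U i)"
    and R: "\<And>i. i \<in> {1..k} \<Longrightarrow> connection_matrix m (R i)"
    and F: "F \<in> spline_space m x k U R" "F 0 = 0"
  shows "F = 0"
proof -
  have zero: "vanishes r (piece x i) 0 t" if "i \<le> k" for r i t
  proof -
    have "const_on {x i..x (Suc i)} 0 = 0" by (auto simp: const_on_def)
    then have "deriv_on (piece x i) 0 = 0"
      using deriv_on_const(2)[OF knots_increasing[OF that], of 0] by (simp add: piece_def)
    then show ?thesis by (induction r) (auto simp: vanishes_Suc)
  qed
  have "F i = 0" if "i \<le> k" for i
    using that
  proof (induction i)
    case 0
    then show ?case using F(2) by simp
  next
    case (Suc i)
    then have i: "i < k" "F i = 0" by auto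
    then have "vanishes m (piece x i) (F i) (x (Suc i))" using zero[of i] by simp
    then have v: "vanishes m (piece x (Suc i)) (F (Suc i)) (x (Suc i))"
      using spline_space_matched[OF R F(1)] i unfolding knot_matched_def by blast
    have "F (Suc i) \<in> U (Suc i)" using F(1) Suc.prems by (simp add: spline_space_def)
    then show ?case
      using EC_space_vanishes_imp_zero[OF EC[OF Suc.prems] _ knot_in_pieces(2)[OF i(1)] v] by blast
  qed
  moreover have "F i = 0" if "i > k" for i using F(1) that by (simp add: spline_space_def pw_C_def)
  ultimately show ?thesis by (metis ext not_le zero_fun_apply)
qed

end

section \<open>The recursion on transition functions\<close>

text \<open>
  The images of \<open>S\<close> under the successive generalized derivatives.
\<close>

primrec reduced_space :: "(nat \<Rightarrow> real) \<Rightarrow> nat \<Rightarrow> (nat \<Rightarrow> pwfun) \<Rightarrow> pwfun set \<Rightarrow> nat \<Rightarrow> pwfun set" where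
  "reduced_space x k w S 0 = S"
| "reduced_space x k w S (Suc j) = (\<lambda>F. pw_D x k F / w (Suc j)) ` reduced_space x k w S j"

context partition
begin

lemma quotient_linear:
  assumes "F \<in> pw_C x k (Suc n)" "G \<in> pw_C x k (Suc n)"
  shows "pw_D x k (F + G) / W = pw_D x k F / W + pw_D x k G / W"
    and "pw_D x k (c *\<^sub>R F) / W = c *\<^sub>R (pw_D x k F / W)"
  unfolding pw_D_add[OF assms] pw_D_scaleR[OF assms(1)]
  by (simp_all add: fun_eq_iff add_divide_distrib)

text \<open>
  Differentiation kills exactly the constants. Since \<^const>\<open>pw_D\<close> is linear only on smooth
  functions, it is replaced by a linear map \<open>D\<close> on the whole space that agrees with it on \<open>S\<close>.
\<close>

lemma dim_pw_D_image:
  assumes subS: "subspace S" and S_C: "S \<subseteq> pw_C x k (Suc n)"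
    and cont: "\<And>F. F \<in> S \<Longrightarrow> knot_continuous F"
    and B: "B \<subseteq> S" "independent B" and spanS: "S \<subseteq> span B" and one_B: "pw_one x k \<in> B"
  shows "dim (pw_D x k ` S) = card B - 1"
proof -
  obtain D where D: "linear D" "\<forall>F\<in>B. D F = pw_D x k F"
    using linear_independent_extend[OF B(2)] by blast
  have D_eq: "D F = pw_D x k F" if "F \<in> S" for F
  proof -
    let ?P = "{F \<in> S. D F = pw_D x k F}"
    have "subspace ?P"
      unfolding subspace_def
    proof (intro conjI ballI allI)
      have "pw_D x k 0 = 0" using pw_D_scaleR[OF pw_C_zero, of 0] unfolding scaleR_zero_left .
      then show "0 \<in> ?P" using linear_0[OF D(1)] subspace_0[OF subS] by simp
      show "F + G \<in> ?P" if "F \<in> ?P" "G \<in> ?P" for F G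
      proof -
        have "D (F + G) = pw_D x k (F + G)"
        proof -
          have *: "F \<in> pw_C x k (Suc n)" "G \<in> pw_C x k (Suc n)"
            "D F = pw_D x k F" "D G = pw_D x k G" using that S_C by blast+
          show ?thesis unfolding linear_add[OF D(1)] pw_D_add[OF *(1,2)] *(3,4) ..
        qed
        then show ?thesis using that subspace_add[OF subS] by blast
      qed
      show "c *\<^sub>R F \<in> ?P" if "F \<in> ?P" for c F
      proof -
        have "D (c *\<^sub>R F) = pw_D x k (c *\<^sub>R F)"
        proof -
          have *: "F \<in> pw_C x k (Suc n)" "D F = pw_D x k F" using that S_C by blast+
          show ?thesis unfolding linear_scale[OF D(1)] pw_D_scaleR[OF *(1)] *(2) ..
        qed
        then show ?thesis using that subspace_scale[OF subS] by blast
      qed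
    qed
    moreover have "B \<subseteq> ?P" using B(1) D(2) by blast
    ultimately have "span B \<subseteq> ?P" by (rule span_minimal[rotated])
    then show ?thesis using that spanS by blast
  qed
  have one_S: "pw_one x k \<in> S" using one_B B(1) by blast
  \<comment> \<open>On the span of the other basis elements \<open>D\<close> is injective: a constant in it would make \<open>B\<close>
    dependent.\<close>
  define A where "A = B - {pw_one x k}"
  have cardA: "card A = card B - 1" using one_B by (simp add: A_def)
  have BA: "B = insert (pw_one x k) A" using one_B by (auto simp: A_def)
  have indA: "independent A" using B(2) unfolding A_def by (rule independent_mono) auto
  have A_S: "span A \<subseteq> S" using B(1) subS by (intro span_minimal) (auto simp: A_def)
  have inj: "inj_on D (span A)"
    unfolding linear_inj_on_iff_eq_0[OF D(1) subspace_span]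
  proof (intro ballI impI)
    fix F assume F: "F \<in> span A" "D F = 0"
    have FS: "F \<in> S" using F(1) A_S by blast
    have "\<exists>c. F = c *\<^sub>R pw_one x k"
      by (rule exI, rule pw_D_zero_imp_const[of F n])
        (use FS S_C D_eq[OF FS] F(2) cont in auto)
    then obtain c where c: "F = c *\<^sub>R pw_one x k" ..
    show "F = 0"
    proof (cases "c = 0")
      case False
      then have "pw_one x k = (1 / c) *\<^sub>R F" unfolding c by simp
      then have "pw_one x k \<in> span A" using span_scale[OF F(1)] by metis
      then show ?thesis using B(2) one_B unfolding A_def dependent_def by blast
    qed (simp add: c)
  qed
  have "S = span B" using spanS B(1) subS by (intro antisym span_minimal)
  then have "pw_D x k ` S = D ` span B" using D_eq by force
  also have "\<dots> = span (insert (D (pw_one x k)) (D ` A))"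
    unfolding linear_span_image[OF D(1), symmetric] BA by simp
  also have "D (pw_one x k) = 0" using D_eq[OF one_S] pw_D_one by simp
  also have "span (insert 0 (D ` A)) = span (D ` A)" by (rule span_insert_0)
  finally have "dim (pw_D x k ` S) = card (D ` A)"
    using linear_independent_injective_image[OF D(1) indA inj]
    by (simp add: dim_eq_card_independent)
  also have "\<dots> = card A" using inj_on_subset[OF inj span_superset] by (rule card_image)
  finally show ?thesis using cardA by simp
qed

text \<open>
  What the recursion preserves when it passes from \<open>n\<close> transition functions \<open>g 1, \<dots>, g n\<close> and
  the space \<open>E\<close> they span to \<open>n - 1\<close> of them. For \<open>n = 1\<close> the spanning condition leaves only
  constants, which is how the chain ends.
\<close>

definition recursion_state :: "nat \<Rightarrow> (nat \<Rightarrow> pwfun) \<Rightarrow> pwfun set \<Rightarrow> bool" where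
  "recursion_state n g E \<longleftrightarrow> subspace E \<and> E \<subseteq> pw_C x k (n - 1) \<and> (\<forall>F\<in>E. knot_matched n F) \<and>
     g 1 = pw_one x k \<and> (\<forall>l\<in>{1..n}. g l \<in> E) \<and> E \<subseteq> span (g ` {1..n})"

text \<open>
  The new functions are the tails \<open>h l = (Dg (l + 1) + \<dots> + Dg n) / W\<close> of the sum \<open>W\<close>. The first
  tail is \<open>W / W = 1\<close>, so constants stay in the space, and differences of neighbouring tails
  return every \<open>Dg l / W\<close>, so the tails span the image.
\<close>

lemma recursion_step:
  assumes st: "recursion_state (Suc (Suc p)) g E"
    and W: "W = (\<Sum>l=2..Suc (Suc p). pw_D x k (g l))" "pw_positive x k W"
    and h: "\<And>l. l \<in> {1..Suc p} \<Longrightarrow> h l = (\<Sum>r=l + 1..Suc (Suc p). pw_D x k (g r)) / W"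
  shows "W \<in> pw_C x k p" and "recursion_state (Suc p) h ((\<lambda>F. pw_D x k F / W) ` E)"
proof -
  let ?T = "\<lambda>F. pw_D x k F / W"
  have E: "subspace E" "E \<subseteq> pw_C x k (Suc p)" "\<And>F. F \<in> E \<Longrightarrow> knot_matched (Suc (Suc p)) F"
    "g 1 = pw_one x k" "\<And>l. l \<in> {1..Suc (Suc p)} \<Longrightarrow> g l \<in> E" "E \<subseteq> span (g ` {1..Suc (Suc p)})"
    using st by (auto simp: recursion_state_def)
  note sm = E(2)[THEN subsetD]
  have one: "pw_one x k \<in> E" using E(4,5) by force
  show WC: "W \<in> pw_C x k p"
    unfolding W(1) by (rule sum_pw_D_C) (use sm E(5) in auto)
  have T_add: "?T (F + G) = ?T F + ?T G" and T_scale: "?T (c *\<^sub>R F) = c *\<^sub>R ?T F"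
    if "F \<in> E" "G \<in> E" for F G c
    using quotient_linear[OF sm[OF that(1)] sm[OF that(2)]] by blast+
  have T_one: "?T (pw_one x k) = 0" unfolding pw_D_one by (simp add: fun_eq_iff)
  have sub: "subspace (?T ` E)"
    unfolding subspace_def
  proof (intro conjI ballI allI)
    show "0 \<in> ?T ` E" using T_one one by (metis image_eqI)
    show "F + G \<in> ?T ` E" if FG: "F \<in> ?T ` E" "G \<in> ?T ` E" for F G
    proof -
      obtain F' G' where *: "F' \<in> E" "F = ?T F'" "G' \<in> E" "G = ?T G'" using FG by blast
      show ?thesis
        unfolding *(2,4) T_add[OF *(1,3), symmetric] by (rule imageI) (rule subspace_add[OF E(1) *(1,3)])
    qed
    show "c *\<^sub>R F \<in> ?T ` E" if F: "F \<in> ?T ` E" for c F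
    proof -
      obtain F' where *: "F' \<in> E" "F = ?T F'" using F by blast
      show ?thesis
        unfolding *(2) T_scale[OF *(1,1), symmetric] by (rule imageI) (rule subspace_scale[OF E(1) *(1)])
    qed
  qed
  have smooth: "?T ` E \<subseteq> pw_C x k p"
    using sm by (auto intro!: pw_C_divide[OF _ WC W(2)] pw_D_C)
  have matched: "knot_matched (Suc p) (?T F)" if F: "F \<in> E" for F
  proof (rule knot_matched_D_divide[OF sm[OF F] WC W(2)])
    show "knot_matched (Suc (Suc p)) (F - c *\<^sub>R pw_one x k)" for c
      by (intro E(3) subspace_diff[OF E(1) F] subspace_scale[OF E(1) one])
  qed
  have h_one: "h 1 = pw_one x k"
  proof -
    have "h 1 = W / W" using h[of 1] by (simp add: W(1) numeral_2_eq_2)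
    then show ?thesis using pw_divide_self[OF W(2) WC] by simp
  qed
  have h_E: "h l \<in> ?T ` E" if l: "l \<in> {1..Suc p}" for l
  proof -
    have gE: "g r \<in> E" if "r \<in> {l + 1..Suc (Suc p)}" for r using that by (intro E(5)) auto
    have "h l = ?T (\<Sum>r=l + 1..Suc (Suc p). g r)"
      using h[OF l] pw_D_sum[of "{l + 1..Suc (Suc p)}" g p] gE sm by (metis finite_atLeastAtMost)
    moreover have "(\<Sum>r=l + 1..Suc (Suc p). g r) \<in> E" using gE by (intro subspace_sum[OF E(1)])
    ultimately show ?thesis by blast
  qed
  have T_g: "?T (g l) \<in> span (h ` {1..Suc p})" if l: "l \<in> {1..Suc (Suc p)}" for l
  proof (cases "l = 1")
    case True
    then show ?thesis using T_one E(4) span_zero by metis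
  next
    case False
    \<comment> \<open>Unlike \<open>h\<close>, the tail also makes sense at the last index, as an empty sum. So every
      \<open>Dg l / W\<close> with \<open>l \<ge> 2\<close> is a difference of two neighbouring tails.\<close>
    let ?tail = "\<lambda>l. (\<Sum>r=l + 1..Suc (Suc p). pw_D x k (g r)) / W"
    have tail: "?tail r \<in> span (h ` {1..Suc p})" if r: "1 \<le> r" "r \<le> Suc (Suc p)" for r
    proof (cases "r = Suc (Suc p)")
      case True
      then have "?tail r = 0" by (simp add: fun_eq_iff)
      then show ?thesis using span_zero by metis
    next
      case False
      then have "r \<in> {1..Suc p}" using r by auto
      then show ?thesis using h[of r] by (metis imageI span_base)
    qed
    have "(\<Sum>r=l..Suc (Suc p). pw_D x k (g r)) = pw_D x k (g l) + (\<Sum>r=l + 1..Suc (Suc p). pw_D x k (g r))"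
      using sum.atLeast_Suc_atMost[of l "Suc (Suc p)" "\<lambda>r. pw_D x k (g r)"] l
      by (metis Suc_eq_plus1 atLeastAtMost_iff)
    moreover have "l - 1 + 1 = l" using l by simp
    moreover have "(F + G) / W = F / W + G / W" for F G :: pwfun
      by (simp add: fun_eq_iff add_divide_distrib)
    ultimately have "?tail (l - 1) = ?T (g l) + ?tail l" by (simp only:)
    then have "?T (g l) = ?tail (l - 1) - ?tail l" by (simp only: add_diff_cancel_right')
    moreover have "?tail (l - 1) - ?tail l \<in> span (h ` {1..Suc p})"
      using False l by (intro span_diff tail) auto
    ultimately show ?thesis by (simp only:)
  qed
  have span: "?T ` E \<subseteq> span (h ` {1..Suc p})"
  proof -
    let ?P = "{F \<in> E. ?T F \<in> span (h ` {1..Suc p})}"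
    have "subspace ?P"
      unfolding subspace_def
    proof (intro conjI ballI allI)
      have "?T 0 = 0" using T_scale[OF one one, of 0] unfolding scaleR_zero_left .
      then show "0 \<in> ?P" using subspace_0[OF E(1)] span_zero by simp
      show "F + G \<in> ?P" if "F \<in> ?P" "G \<in> ?P" for F G
      proof -
        have "?T (F + G) \<in> span (h ` {1..Suc p})"
          using that T_add[of F G] span_add[of "?T F" _ "?T G"] by simp
        with that show ?thesis using subspace_add[OF E(1)] by blast
      qed
      show "c *\<^sub>R F \<in> ?P" if "F \<in> ?P" for c F
      proof -
        have "?T (c *\<^sub>R F) \<in> span (h ` {1..Suc p})"
          using that T_scale[of F F c] span_scale[of "?T F" _ c] by simp
        with that show ?thesis using subspace_scale[OF E(1)] by blast
      qed
    qed
    moreover have "g ` {1..Suc (Suc p)} \<subseteq> ?P" using T_g E(5) by blast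
    ultimately have "span (g ` {1..Suc (Suc p)}) \<subseteq> ?P" by (rule span_minimal[rotated])
    then show ?thesis using E(6) by blast
  qed
  show "recursion_state (Suc p) h (?T ` E)"
    unfolding recursion_state_def using sub smooth matched h_one h_E span by simp
qed

end

theorem proposition6:
  fixes m k :: nat
    and x :: "nat \<Rightarrow> real"
    and U :: "nat \<Rightarrow> (real \<Rightarrow> real) set"
    and R :: "nat \<Rightarrow> nat \<Rightarrow> nat \<Rightarrow> real"
    and S :: "pwfun set"
    and f :: "nat \<Rightarrow> nat \<Rightarrow> pwfun"
    and w :: "nat \<Rightarrow> pwfun"
  assumes "m \<ge> 2"
    and "\<forall>i\<le>k. x i < x (Suc i)"
    and "\<forall>i\<le>k. EC_space m (piece x i) (U i)"
    and "\<forall>i\<le>k. \<forall>c. const_on (piece x i) c \<in> U i"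
    and "\<forall>i\<le>k. EC_space (m - 1) (piece x i) (deriv_on (piece x i) ` U i)"
    and "\<forall>i\<in>{1..k}. connection_matrix m (R i)"
    and "S = spline_space m x k U R"
    and "pw_one x k \<in> S"
    and "transition_functions m x k S (\<lambda>l. f l m)"
    and "inj_on (\<lambda>l. f l m) {1..m}"
    and "independent ((\<lambda>l. f l m) ` {1..m})"
    and "\<forall>j\<in>{1..m - 1}. w j = (\<Sum>l=2..m - j + 1. pw_D x k (f l (m - j + 1)))"
    and "\<forall>j\<in>{1..m - 1}. \<forall>l\<in>{1..m - j}.
           f l (m - j) = (\<Sum>h=l + 1..m - j + 1. pw_D x k (f h (m - j + 1))) / w j"
    and "\<forall>j\<in>{1..m - 1}. pw_positive x k (w j)"
  shows "is_ECP x k m (\<lambda>j. if j = 0 then pw_one x k else w j) S \<and>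
         is_ECP x k (m - 1) (\<lambda>j. w (Suc j)) (pw_D x k ` S)"
proof -
  interpret partition x k using assms(2) by unfold_locales blast
  obtain N where m: "m = Suc N" and N: "N \<ge> 1" using assms(1) by (cases m) auto
  define B where "B = (\<lambda>l. f l m) ` {1..m}"
  have EC: "\<And>i. i \<le> k \<Longrightarrow> EC_space m (piece x i) (U i)" using assms(3) by blast
  have conn: "\<And>i. i \<in> {1..k} \<Longrightarrow> connection_matrix m (R i)" using assms(6) by blast
  have subS: "subspace S"
    unfolding assms(7) m by (rule spline_space_subspace) (use EC in \<open>simp add: EC_space_def\<close>)
  have f_S: "f l m \<in> S" if "l \<in> {1..m}" for l
    using assms(9) that by (simp add: transition_functions_def)
  have f_1: "f 1 m = pw_one x k" using assms(9) by (simp add: transition_functions_def)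
  have B: "B \<subseteq> S" "independent B" "card B = m"
    using f_S assms(11) card_image[OF assms(10)] by (auto simp: B_def)
  have S_C: "S \<subseteq> pw_C x k N" unfolding assms(7) m by (auto simp: spline_space_def)
  \<comment> \<open>Independence alone does not make the transition functions a basis; the dimension of \<open>S\<close>
    is at most that of \<open>U 0\<close> because a spline is determined by its first piece.\<close>
  have spanS: "S \<subseteq> span B"
  proof (rule subspace_spanned_via_injection[where ev = "\<lambda>F. F 0" and U = "U 0" and n = m])
    show "linear (\<lambda>F::pwfun. F 0)" by (rule linearI) simp_all
    show "v = 0" if "v \<in> S" "v 0 = 0" for v
      using spline_determined_by_first_piece[OF EC, of R v] conn that unfolding assms(7) by blast
    show "(\<lambda>F. F 0) ` S \<subseteq> U 0" unfolding assms(7) by (auto simp: spline_space_def)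
    show "dim (U 0) = m" using EC[of 0] by (simp add: EC_space_def)
  qed (use subS B assms(1) in auto)
  have dimS: "dim S = m" using B spanS by (intro dim_unique) auto
  define E where "E = reduced_space x k w S"
  have state: "recursion_state (Suc (N - j)) (\<lambda>l. f l (Suc (N - j))) (E j)" if "j \<le> N" for j
    using that
  proof (induction j)
    case 0
    show ?case
      unfolding recursion_state_def E_def using subS S_C f_S f_1 spanS
        spline_space_matched[of m R _ U] conn unfolding assms(7) B_def m by simp
  next
    case (Suc j)
    then obtain p where p: "N - j = Suc p" by (cases "N - j") auto
    have ix: "Suc j \<in> {1..m - 1}" "m - Suc j + 1 = Suc (Suc p)" "m - Suc j = Suc p" "N - Suc j = p"
      using p Suc.prems by (auto simp: m)
    have "recursion_state (Suc p) (\<lambda>l. f l (Suc p)) ((\<lambda>F. pw_D x k F / w (Suc j)) ` E j)"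
    proof (rule recursion_step(2)[where g = "\<lambda>l. f l (Suc (Suc p))"])
      show "recursion_state (Suc (Suc p)) (\<lambda>l. f l (Suc (Suc p))) (E j)"
        using Suc.IH Suc.prems unfolding p by simp
      show "w (Suc j) = (\<Sum>l = 2..Suc (Suc p). pw_D x k (f l (Suc (Suc p))))"
        using assms(12)[rule_format, OF ix(1)] unfolding ix(2) .
      show "pw_positive x k (w (Suc j))" using assms(14) ix(1) by blast
      show "f l (Suc p) = (\<Sum>r = l + 1..Suc (Suc p). pw_D x k (f r (Suc (Suc p)))) / w (Suc j)"
        if "l \<in> {1..Suc p}" for l
        using assms(13)[rule_format, OF ix(1), unfolded ix(3), OF that] by (simp only: Suc_eq_plus1)
    qed
    then show ?case unfolding ix(4) E_def by simp
  qed
  have w_pos: "pw_positive x k (w (Suc j))" if "j < N" for j using assms(14) that by (simp add: m)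
  have w_smooth: "w (Suc j) \<in> pw_C x k (N - Suc j)" if "j < N" for j
  proof -
    obtain p where p: "N - j = Suc p" using \<open>j < N\<close> by (cases "N - j") auto
    have ix: "Suc j \<in> {1..m - 1}" "m - Suc j + 1 = Suc (Suc p)" "N - Suc j = p"
      using p \<open>j < N\<close> by (auto simp: m)
    have st: "recursion_state (Suc (Suc p)) (\<lambda>l. f l (Suc (Suc p))) (E j)"
      using state[of j] \<open>j < N\<close> unfolding p by simp
    show ?thesis
      unfolding ix(3) assms(12)[rule_format, OF ix(1), unfolded ix(2)]
    proof (rule sum_pw_D_C)
      show "f l (Suc (Suc p)) \<in> pw_C x k (Suc p)" if "l \<in> {2..Suc (Suc p)}" for l
        using st that unfolding recursion_state_def by auto
    qed
  qed
  interpret weight_chain x k N E w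
  proof unfold_locales
    fix j assume j: "j \<le> N"
    note st = state[OF j, unfolded recursion_state_def]
    show sub: "subspace (E j)" using st by blast
    show one: "pw_one x k \<in> E j" using st by (metis One_nat_def Suc_le_mono atLeastAtMost_iff le0 order_refl)
    show "E j \<subseteq> pw_C x k (N - j)" using st by simp
    show "knot_continuous F" if F: "F \<in> E j" for F
    proof (rule knot_matched_imp_continuous)
      show "knot_matched (Suc (N - j)) (F - c *\<^sub>R pw_one x k)" for c
        using st subspace_diff[OF sub F subspace_scale[OF sub one]] by blast
    qed
  next
    fix j assume "j < N"
    then show "pw_positive x k (w (Suc j))" "w (Suc j) \<in> pw_C x k (N - Suc j)"
      by (rule w_pos, rule w_smooth)
    show "E (Suc j) = (\<lambda>F. pw_D x k F / w (Suc j)) ` E j" by (simp add: E_def)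
  next
    fix F assume "F \<in> E N"
    then have "F \<in> span {pw_one x k}" using state[of N] by (auto simp: recursion_state_def)
    then show "\<exists>c. F = c *\<^sub>R pw_one x k" by (auto simp: span_singleton)
  qed
  have E0: "E 0 = S" by (simp add: E_def)
  have one_pos: "pw_positive x k (pw_one x k)" by (simp add: pw_positive_def pw_one_def const_on_def)
  have "is_ECP x k (Suc (N - 0)) (\<lambda>j. if j = 0 then pw_one x k else w j) S"
  proof (rule is_ECP_level)
    show "S = {F \<in> pw_C x k (N - 0). F / (if 0 = (0::nat) then pw_one x k else w 0) \<in> E 0}"
      using S_C pw_divide_one by (auto simp: E0)
  qed (use dimS m one_pos pw_one_C in auto)
  moreover have "is_ECP x k (Suc (N - 1)) (\<lambda>j. w (Suc j)) (pw_D x k ` S)"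
  proof (rule is_ECP_level)
    have w1: "pw_positive x k (w (Suc 0))" "w (Suc 0) \<in> pw_C x k (N - 1)"
      using w_pos[of 0] w_smooth[of 0] N by auto
    then show "pw_positive x k (w (Suc 0))" "w (Suc 0) \<in> pw_C x k (N - 1)" by auto
    have NS: "N = Suc (N - 1)" using N by simp
    have S_C': "S \<subseteq> pw_C x k (Suc (N - 1))" using S_C NS by simp
    show "pw_D x k ` S = {F \<in> pw_C x k (N - 1). F / w (Suc 0) \<in> E 1}"
    proof (intro equalityI subsetI)
      fix G assume "G \<in> pw_D x k ` S"
      then obtain F where F: "F \<in> S" "G = pw_D x k F" by blast
      have "G \<in> pw_C x k (N - 1)" unfolding F(2) using pw_D_C S_C' F(1) by blast
      moreover have "G / w (Suc 0) \<in> E 1" unfolding F(2) E_def using F(1) by auto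
      ultimately show "G \<in> {F \<in> pw_C x k (N - 1). F / w (Suc 0) \<in> E 1}" by blast
    next
      fix G assume G: "G \<in> {F \<in> pw_C x k (N - 1). F / w (Suc 0) \<in> E 1}"
      then obtain F where F: "F \<in> S" "G / w (Suc 0) = pw_D x k F / w (Suc 0)" by (auto simp: E_def)
      have "pw_D x k F \<in> pw_C x k (N - 1)" using pw_D_C S_C' F(1) by blast
      with G F(2) have "G = pw_D x k F" using pw_divide_cancel[OF _ _ w1(1)] by blast
      then show "G \<in> pw_D x k ` S" using F(1) by blast
    qed
    show "dim (pw_D x k ` S) = Suc (N - 1)"
    proof -
      have "pw_one x k \<in> B" unfolding B_def f_1[symmetric] using m by simp
      moreover have "knot_continuous F" if "F \<in> S" for F using continuous_E[of 0 F] that E0 by simp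
      ultimately have "dim (pw_D x k ` S) = card B - 1"
        using dim_pw_D_image[OF subS S_C' _ B(1,2) spanS] by blast
      then show ?thesis using B(3) m N by simp
    qed
  qed (use N in auto)
  ultimately show ?thesis using m N by simp
qed

end
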